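(* Let $\alpha\ge0$ and let $f=h+\overline{g}\in\mathcal{W}^{0}_{\mathcal{H}}(\alpha)$ with $h(z)=z+\sum_{n=2}^\infty a_nz^n$, $g(z)=\sum_{n=2}^\infty b_nz^n$. Let $r_f$ be the unique root in $(0,1)$ of $$r+2\sum_{n=2}^{\infty}\frac{r^n}{\alpha n^2+n(1-\alpha)}=1+2\sum_{n=2}^{\infty}\frac{(-1)^{n-1}}{\alpha n^2+n(1-\alpha)}.$$ Then $$|z|+\sum_{n=2}^{\infty}(|a_n|+|b_n|)|z|^n\le d(f(0),\partial f(\mathbb{D}))\quad\text{for all }|z|\le r_f.$$ The radius $r_f$ is best possible: for $f_\alpha(z)=z+\sum_{n=2}^\infty\frac{2}{\alpha n^2+n(1-\alpha)}z^n\in\mathcal{W}^{0}_{\mathcal{H}}(\alpha)$, equality holds when $|z|=r_f$, and the inequality fails for every $|z|\in(r_f,1)$.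
   Context: $\mathbb{D}=\{z\in\mathbb{C}:|z|<1\}$. $\mathcal{H}_0$ denotes the class of harmonic functions $f=h+\overline{g}$ on $\mathbb{D}$, where $h,g$ are analytic in $\mathbb{D}$ of the form $h(z)=z+\sum_{n=2}^\infty a_nz^n$ and $g(z)=\sum_{n=2}^\infty b_nz^n$. For $\alpha\ge0$, $\mathcal{W}^{0}_{\mathcal{H}}(\alpha)$ is the set of $f=h+\overline{g}\in\mathcal{H}_0$ such that $\operatorname{Re}\big(h'(z)+\alpha zh''(z)\big)>|g'(z)+\alpha zg''(z)|$ for all $z\in\mathbb{D}$. For a function $f$ on $\mathbb{D}$, $d(f(0),\partial f(\mathbb{D}))=\inf\{|w-f(0)|: w\in\partial f(\mathbb{D})\}$ is the Euclidean distance from $f(0)$ to the boundary of $f(\mathbb{D})$. *)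

theory Defs
  imports "HOL-Analysis.Analysis"
begin

definition tcoeff :: "(complex \<Rightarrow> complex) \<Rightarrow> nat \<Rightarrow> complex" where
  "tcoeff h n = (deriv ^^ n) h 0 / of_nat (fact n)"

text \<open>The class W^0_H(alpha), for f = h + conj g given by the pair (h, g).\<close>
definition W0H :: "real \<Rightarrow> (complex \<Rightarrow> complex) \<Rightarrow> (complex \<Rightarrow> complex) \<Rightarrow> bool" where
  "W0H \<alpha> h g \<longleftrightarrow>
     h holomorphic_on ball 0 1 \<and> g holomorphic_on ball 0 1 \<and>
     h 0 = 0 \<and> deriv h 0 = 1 \<and> g 0 = 0 \<and> deriv g 0 = 0 \<and>
     (\<forall>z\<in>ball 0 1. Re (deriv h z + of_real \<alpha> * z * deriv (deriv h) z)
                      > cmod (deriv g z + of_real \<alpha> * z * deriv (deriv g) z))"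

definition bdist :: "(complex \<Rightarrow> complex) \<Rightarrow> real" where
  "bdist f = Inf ((\<lambda>w. cmod (w - f 0)) ` frontier (f ` ball 0 1))"

definition majorant :: "(complex \<Rightarrow> complex) \<Rightarrow> (complex \<Rightarrow> complex) \<Rightarrow> real \<Rightarrow> real" where
  "majorant h g r = r + (\<Sum>n. (cmod (tcoeff h (n+2)) + cmod (tcoeff g (n+2))) * r ^ (n+2))"

definition den :: "real \<Rightarrow> nat \<Rightarrow> real" where
  "den \<alpha> n = \<alpha> * (real n)^2 + real n * (1 - \<alpha>)"

definition rootLHS :: "real \<Rightarrow> real \<Rightarrow> real" where
  "rootLHS \<alpha> r = r + 2 * (\<Sum>n. r ^ (n+2) / den \<alpha> (n+2))"

definition rootRHS :: "real \<Rightarrow> real" where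
  "rootRHS \<alpha> = 1 + 2 * (\<Sum>n. (-1) ^ (n+1) / den \<alpha> (n+2))"

text \<open>Extremal function f_alpha (analytic part; co-analytic part is 0).\<close>
definition h_ext :: "real \<Rightarrow> complex \<Rightarrow> complex" where
  "h_ext \<alpha> z = z + (\<Sum>n. of_real (2 / den \<alpha> (n+2)) * z ^ (n+2))"

end

theory Submission
  imports Defs "HOL-Complex_Analysis.Complex_Analysis"
begin

text \<open>
  For unimodular \<open>u, v\<close> the analytic function \<open>F z = cnj u * h (u z) + v * g (u z)\<close> satisfies
  \<open>Re (F' + \<alpha> z F'') > 0\<close>, which reduces everything to functions of positive real part.
  Caratheodory's bound on their Taylor coefficients, with \<open>v\<close> aligning the two terms, gives
  \<open>|a\<^sub>n| + |b\<^sub>n| \<le> 2 / den \<alpha> n\<close>, so the majorant is at most \<open>rootLHS\<close>. Harnack's inequality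
  and a comparison with \<open>- h_ext \<alpha> (- z)\<close>, for which Harnack is sharp, give with \<open>v = u\<close> the
  growth bound \<open>|f z| \<ge> - h_ext \<alpha> (- |z|)\<close>, whose right side tends to \<open>rootRHS\<close> as \<open>|z| \<rightarrow> 1\<close>.
  Since \<open>Re h' > |g'|\<close>, \<open>f\<close> is injective and open, so frontier points of the image
  are limits of \<open>f\<close> along sequences approaching the unit circle. The frontier is nonempty because the
  coefficient bound makes the quadratic means of \<open>f\<close> on circles bounded, which yields such a
  convergent sequence, and its limit is not a value of \<open>f\<close>.
\<close>

subsection \<open>Coefficients of functions with positive real part\<close>

text \<open>The powers of the \<open>N\<close>-th roots of unity are orthogonal, so averaging over
  the roots recovers each coefficient of a polynomial of degree below \<open>N\<close>. This is a
  finite substitute for Cauchy's coefficient integral.\<close>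

lemma discrete_fourier_coeff:
  fixes a :: "nat \<Rightarrow> complex" and N k :: nat
  defines "x \<equiv> (\<lambda>j::nat. cis (2 * pi * real j / real N))"
  assumes k: "k < N"
  shows "(\<Sum>j<N. (\<Sum>n<N. a n * x j ^ n) * cnj (x j) ^ k) = of_nat N * a k"
proof -
  have orth: "(\<Sum>j<N. x j ^ n * cnj (x j) ^ k) = (if n = k then of_nat N else 0)" if n: "n < N" for n
  proof -
    define \<theta> where "\<theta> = 2 * pi * (real n - real k) / real N"
    have pw: "x j ^ n * cnj (x j) ^ k = cis \<theta> ^ j" for j
      by (simp add: x_def Complex.DeMoivre cis_cnj cis_mult \<theta>_def algebra_simps diff_divide_distrib)
    show ?thesis
    proof (cases "n = k")
      case True
      then show ?thesis unfolding pw by (simp add: \<theta>_def)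
    next
      case False
      \<comment> \<open>Otherwise \<open>N\<close> would divide the nonzero difference
        \<open>n - k\<close>, although both indices lie below \<open>N\<close>.\<close>
      have "cis \<theta> \<noteq> 1"
      proof
        assume "cis \<theta> = 1"
        then have "cos \<theta> = 1" by (metis cis.sel(1) one_complex.sel(1))
        then obtain m :: int where "\<theta> = of_int m * 2 * pi"
          using cos_one_2pi_int by auto
        then have "pi * (2 * (real n - real k)) = pi * (2 * (real_of_int m * real N))"
          using k by (simp add: \<theta>_def field_simps)
        then have "real n - real k = real_of_int m * real N"
          unfolding mult_cancel_left by simp
        then have "int n - int k = m * int N"
          by (metis (mono_tags, lifting) of_int_diff of_int_eq_iff of_int_mult of_int_of_nat_eq)
        moreover from this False have "m \<noteq> 0" by auto
        then have "1 * int N \<le> \<bar>m\<bar> * int N" by (intro mult_right_mono) auto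
        ultimately have "\<bar>int n - int k\<bar> \<ge> int N" by (simp add: abs_mult)
        then show False using n k by linarith
      qed
      moreover have "cis \<theta> ^ N = 1"
      proof -
        have "cis \<theta> ^ N = cis (2 * pi * (real n - real k))"
          using k by (simp add: Complex.DeMoivre \<theta>_def)
        also have "\<dots> = 1" by (rule cis_multiple_2pi) auto
        finally show ?thesis .
      qed
      ultimately show ?thesis
        using False by (simp add: pw geometric_sum)
    qed
  qed
  have "(\<Sum>j<N. (\<Sum>n<N. a n * x j ^ n) * cnj (x j) ^ k)
      = (\<Sum>n<N. a n * (\<Sum>j<N. x j ^ n * cnj (x j) ^ k))"
    by (simp add: sum_distrib_left sum_distrib_right mult.assoc) (rule sum.swap)
  also have "\<dots> = (\<Sum>n<N. if n = k then of_nat N * a k else 0)"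
    by (rule sum.cong) (auto simp: orth)
  also have "\<dots> = of_nat N * a k" using k by simp
  finally show ?thesis .
qed

lemma discrete_parseval:
  fixes a :: "nat \<Rightarrow> complex" and N :: nat
  defines "x \<equiv> (\<lambda>j::nat. cis (2 * pi * real j / real N))"
  shows "(\<Sum>j<N. (cmod (\<Sum>n<N. a n * x j ^ n))\<^sup>2) = real N * (\<Sum>n<N. (cmod (a n))\<^sup>2)"
proof -
  define S where "S = (\<lambda>j. \<Sum>n<N. a n * x j ^ n)"
  have "complex_of_real (\<Sum>j<N. (cmod (S j))\<^sup>2) = (\<Sum>j<N. S j * cnj (S j))"
    by (simp only: of_real_sum complex_norm_square)
  also have "\<dots> = (\<Sum>j<N. \<Sum>k<N. cnj (a k) * (S j * cnj (x j) ^ k))"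
    by (subst (2) S_def) (simp add: sum_distrib_left mult_ac)
  also have "\<dots> = (\<Sum>k<N. cnj (a k) * (\<Sum>j<N. S j * cnj (x j) ^ k))"
    by (subst sum.swap) (simp add: sum_distrib_left)
  also have "\<dots> = (\<Sum>k<N. cnj (a k) * (of_nat N * a k))"
    by (rule sum.cong) (simp_all add: S_def x_def discrete_fourier_coeff)
  also have "\<dots> = complex_of_real (real N * (\<Sum>n<N. (cmod (a n))\<^sup>2))"
    by (simp add: sum_distrib_left complex_norm_square mult_ac del: of_real_power)
  finally show ?thesis unfolding S_def of_real_eq_iff .
qed

text \<open>Convergence at a slightly larger radius makes the series absolutely summable on the
  circle, and the tail of the moduli does not depend on \<open>z\<close>. Allowing every
  \<open>M\<close> beyond \<open>M0\<close> lets several series share one truncation.\<close>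

lemma powser_tail_uniform:
  fixes p :: "nat \<Rightarrow> complex"
  assumes P: "\<And>z. cmod z < 1 \<Longrightarrow> (\<lambda>n. p n * z ^ n) sums P z"
    and r: "0 \<le> r" "r < 1" and "0 < \<delta>"
  shows "\<exists>M0. \<forall>M\<ge>M0. \<forall>z. cmod z = r \<longrightarrow> cmod (P z - (\<Sum>n<M. p n * z ^ n)) \<le> \<delta>"
proof -
  obtain r' where r': "r < r'" "r' < 1" using dense[OF r(2)] by blast
  have "summable (\<lambda>n. p n * of_real r' ^ n)"
    using P[of "of_real r'"] r' r by (auto simp: sums_iff)
  then have sm: "summable (\<lambda>n. cmod (p n) * r ^ n)"
    using powser_insidea[of p "of_real r'" "of_real r"] r' r
    by (simp add: norm_mult norm_power)
  have "(\<lambda>M. (\<Sum>n. cmod (p (n + M)) * r ^ (n + M))) \<longlonglongrightarrow> 0"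
    using suminf_exist_split2[OF sm] by simp
  then have "eventually (\<lambda>M. (\<Sum>n. cmod (p (n + M)) * r ^ (n + M)) < \<delta>) sequentially"
    using order_tendstoD(2) \<open>0 < \<delta>\<close> by blast
  then obtain M0 where M0: "\<And>M. M \<ge> M0 \<Longrightarrow> (\<Sum>n. cmod (p (n + M)) * r ^ (n + M)) < \<delta>"
    by (auto simp: eventually_sequentially)
  have "cmod (P z - (\<Sum>n<M. p n * z ^ n)) \<le> \<delta>" if "M \<ge> M0" "cmod z = r" for M z
  proof -
    have "(\<lambda>n. p n * z ^ n) sums P z" using P r that by auto
    then have "P z - (\<Sum>n<M. p n * z ^ n) = (\<Sum>n. p (n + M) * z ^ (n + M))"
      using suminf_minus_initial_segment[of "\<lambda>n. p n * z ^ n" M] by (simp add: sums_iff)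
    also have "cmod \<dots> \<le> (\<Sum>n. cmod (p (n + M) * z ^ (n + M)))"
      by (rule summable_norm) (use summable_ignore_initial_segment[OF sm, of M] that in
          \<open>simp add: norm_mult norm_power\<close>)
    also have "\<dots> < \<delta>" using M0[OF that(1)] that(2) by (simp add: norm_mult norm_power)
    finally show ?thesis by simp
  qed
  then show ?thesis by blast
qed

text \<open>Caratheodory's argument by sampling: the \<open>k\<close>-th coefficient is the mean of
  \<open>2 * Re S\<close> against a unimodular factor, and for nearly nonnegative
  \<open>Re S\<close> its modulus is nearly at most the mean of \<open>2 * Re S\<close>, which is 2.
  Letting \<delta> tend to 0 and \<open>r\<close> to 1 removes the errors.\<close>

lemma positive_real_part_coeff_bound:
  fixes p :: "nat \<Rightarrow> complex"
  assumes P: "\<And>z. cmod z < 1 \<Longrightarrow> (\<lambda>n. p n * z ^ n) sums P z"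
    and pos: "\<And>z. cmod z < 1 \<Longrightarrow> 0 < Re (P z)"
    and p0: "p 0 = 1" and k: "0 < k"
  shows "cmod (p k) \<le> 2"
proof -
  have step: "cmod (p k) * r ^ k \<le> 2 + 4 * \<delta>" if r: "0 < r" "r < 1" and \<delta>: "0 < \<delta>" for r \<delta> :: real
  proof -
    obtain M where M: "M > k" "\<And>z. cmod z = r \<Longrightarrow> cmod (P z - (\<Sum>n<M. p n * z ^ n)) \<le> \<delta>"
      using powser_tail_uniform[OF P, of r \<delta>] r \<delta>
      by (metis Suc_le_lessD less_le nle_le)
    \<comment> \<open>With \<open>k\<close> more nodes than coefficients, index \<open>N - k\<close>
      lies beyond the truncation, so \<open>a (N - k) = 0\<close>.\<close>
    define N where "N = M + k"
    define a where "a = (\<lambda>n. if n < M then p n * of_real r ^ n else 0)"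
    define x where "x = (\<lambda>j::nat. cis (2 * pi * real j / real N))"
    define S where "S = (\<lambda>j. \<Sum>n<N. a n * x j ^ n)"
    have N: "N > 0" "k < N" "N - k < N" "M \<le> N - k" using M k by (auto simp: N_def)
    have Seq: "S j = (\<Sum>n<M. p n * (of_real r * x j) ^ n)" for j
    proof -
      have "S j = (\<Sum>n<M. a n * x j ^ n)"
        unfolding S_def by (rule sum.mono_neutral_right) (auto simp: a_def N_def)
      then show ?thesis by (simp add: a_def power_mult_distrib mult_ac)
    qed
    have nx: "cmod (x j) = 1" for j by (simp add: x_def)
    have close: "cmod (P (of_real r * x j) - S j) \<le> \<delta>" for j
      unfolding Seq by (rule M(2)) (use r in \<open>simp add: norm_mult nx\<close>)
    have ReS: "Re (S j) \<ge> - \<delta>" for j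
    proof -
      have "Re (P (of_real r * x j)) > 0" using pos r by (simp add: norm_mult nx)
      moreover have "Re (P (of_real r * x j) - S j) \<le> \<delta>"
        using close[of j] complex_Re_le_cmod order_trans by blast
      ultimately show ?thesis by simp
    qed
    have xN: "x j ^ N = 1" for j
      using N cis_multiple_2pi[of "real j"] by (simp add: x_def Complex.DeMoivre)
    \<comment> \<open>On roots of unity the power \<open>k\<close> is the conjugate power
      \<open>N - k\<close>; hence the conjugate of \<open>S\<close> contributes nothing to the
      \<open>k\<close>-th coefficient of \<open>2 * Re S\<close>.\<close>
    have xk: "x j ^ k = cnj (x j) ^ (N - k)" for j
    proof -
      have "x j * cnj (x j) = 1" by (simp add: x_def cis_cnj cis_mult)
      moreover have "x j ^ k * x j ^ (N - k) = 1"
        using xN[of j] N by (simp flip: power_add)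
      ultimately show ?thesis
        by (metis (no_types, lifting) mult.assoc mult.commute mult_1 power_mult_distrib power_one)
    qed
    have e1: "(\<Sum>j<N. S j * cnj (x j) ^ k) = of_nat N * a k"
      unfolding S_def x_def using N by (intro discrete_fourier_coeff)
    have "(\<Sum>j<N. S j * x j ^ k) = of_nat N * a (N - k)"
      unfolding xk unfolding S_def x_def using N by (intro discrete_fourier_coeff)
    also have "\<dots> = 0" using N by (simp add: a_def)
    finally have "cnj (\<Sum>j<N. S j * x j ^ k) = 0" by simp
    then have e2: "(\<Sum>j<N. cnj (S j) * cnj (x j) ^ k) = 0" by simp
    have e3: "(\<Sum>j<N. S j) = of_nat N"
      using discrete_fourier_coeff[of 0 N a] N M p0 by (simp add: S_def x_def a_def)
    have "of_real (2 * Re (S j)) * cnj (x j) ^ k = S j * cnj (x j) ^ k + cnj (S j) * cnj (x j) ^ k" for j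
      by (simp add: complex_add_cnj flip: ring_distribs(2))
    then have "of_nat N * a k = (\<Sum>j<N. of_real (2 * Re (S j)) * cnj (x j) ^ k)"
      using e1 e2 by (simp add: sum.distrib)
    then have "cmod (of_nat N * a k) \<le> (\<Sum>j<N. cmod (of_real (2 * Re (S j)) * cnj (x j) ^ k))"
      by (metis norm_sum)
    also have "\<dots> = (\<Sum>j<N. \<bar>2 * Re (S j)\<bar>)"
      by (simp add: norm_mult norm_power nx abs_mult)
    \<comment> \<open>Where \<open>Re (S j)\<close> is negative it is at least -\<delta>, so
      replacing the absolute value costs at most \<open>4 * \<delta>\<close>.\<close>
    also have "\<dots> \<le> (\<Sum>j<N. 2 * Re (S j) + 4 * \<delta>)"
      proof (rule sum_mono)
      fix j
      show "\<bar>2 * Re (S j)\<bar> \<le> 2 * Re (S j) + 4 * \<delta>"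
        using ReS[of j] \<delta> by (simp add: abs_if)
    qed
    also have "\<dots> = 2 * Re (\<Sum>j<N. S j) + N * (4 * \<delta>)"
      by (simp add: sum.distrib sum_distrib_left)
    also have "\<dots> = N * (2 + 4 * \<delta>)" by (simp add: e3 algebra_simps)
    finally have "real N * cmod (a k) \<le> real N * (2 + 4 * \<delta>)" by (simp add: norm_mult)
    then have "cmod (a k) \<le> 2 + 4 * \<delta>" using N by simp
    then show ?thesis using M r by (simp add: a_def norm_mult norm_power)
  qed
  have "cmod (p k) * r ^ k \<le> 2" if "0 < r" "r < 1" for r
  proof (rule field_le_epsilon)
    fix e :: real assume "0 < e"
    then show "cmod (p k) * r ^ k \<le> 2 + e" using step[OF that, of "e/4"] by simp
  qed
  then have ev: "eventually (\<lambda>r. cmod (p k) * r ^ k \<le> 2) (at_left 1)"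
    unfolding eventually_at_left_field by (metis zero_less_one)
  have "((\<lambda>r. cmod (p k) * r ^ k) \<longlongrightarrow> cmod (p k) * 1 ^ k) (at_left 1)"
    by (intro tendsto_intros)
  then show ?thesis using tendsto_upperbound[OF _ ev] by simp
qed

section \<open>Taylor coefficients and the differential operator of the class\<close>

lemma tcoeff_sums:
  assumes "F holomorphic_on ball 0 1" "cmod z < 1"
  shows "(\<lambda>n. tcoeff F n * z ^ n) sums F z"
  using holomorphic_power_series[OF assms(1), of z] assms(2) by (simp add: tcoeff_def)

lemma tcoeff_eqI:
  assumes "\<And>z. cmod z < 1 \<Longrightarrow> (\<lambda>n. c n * z ^ n) sums F z"
  shows "tcoeff F n = c n"
proof -
  have "F has_fps_expansion Abs_fps c"
    by (rule has_fps_expansionI)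
      (use assms eventually_nhds_in_open[of "ball (0::complex) 1" 0] in
        \<open>auto elim!: eventually_mono\<close>)
  from fps_nth_fps_expansion[OF this, of n] show ?thesis
    by (simp add: tcoeff_def)
qed

text \<open>The operator sends \<open>z ^ n\<close> to \<open>den \<alpha> n * z ^ (n - 1)\<close>,
  which is the origin of the denominators \<open>den\<close>.\<close>

definition euler_op :: "real \<Rightarrow> (complex \<Rightarrow> complex) \<Rightarrow> complex \<Rightarrow> complex" where
  "euler_op \<alpha> F z = deriv F z + of_real \<alpha> * z * deriv (deriv F) z"

lemma den_Suc: "den \<alpha> (Suc n) = (real n + 1) * (1 + \<alpha> * real n)"
  by (simp add: den_def power2_eq_square algebra_simps)

lemma den_ge: "\<alpha> \<ge> 0 \<Longrightarrow> den \<alpha> n \<ge> real n"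
proof (cases n)
  case (Suc m)
  assume "\<alpha> \<ge> 0"
  then have "(real m + 1) * 1 \<le> (real m + 1) * (1 + \<alpha> * real m)"
    by (intro mult_left_mono) auto
  then show ?thesis by (simp only: Suc den_Suc of_nat_Suc mult_1_right add.commute)
qed (simp add: den_def)

lemma den_mono:
  assumes "\<alpha> \<ge> 0" "m \<le> n"
  shows "den \<alpha> m \<le> den \<alpha> n"
  using assms(2)
proof (induction rule: dec_induct)
  case (step n)
  have "den \<alpha> (Suc n) - den \<alpha> n = 1 + 2 * \<alpha> * real n"
    by (simp add: den_def power2_eq_square algebra_simps)
  then show ?case using step assms(1) by (smt (verit) mult_nonneg_nonneg of_nat_0_le_iff)
qed simp

lemma euler_op_sums:
  assumes F: "F holomorphic_on ball 0 1" and z: "cmod z < 1"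
  shows "(\<lambda>n. of_real (den \<alpha> (Suc n)) * tcoeff F (Suc n) * z ^ n) sums euler_op \<alpha> F z"
proof -
  let ?c = "tcoeff F"
  have F': "deriv F holomorphic_on ball 0 1" using F by (intro holomorphic_deriv) auto
  have d1: "(\<lambda>n. diffs ?c n * w ^ n) sums deriv F w" if "cmod w < 1" for w
    using termdiffs_sums_strong[of 1 ?c F "deriv F w" w] tcoeff_sums[OF F] that F
      holomorphic_derivI[of F "ball 0 1" w] by auto
  have "(\<lambda>n. diffs (diffs ?c) n * z ^ n) sums deriv (deriv F) z"
    using termdiffs_sums_strong[of 1 "diffs ?c" "deriv F" "deriv (deriv F) z" z] d1 z F'
      holomorphic_derivI[of "deriv F" "ball 0 1" z] by auto
  then have "(\<lambda>n. z * (diffs (diffs ?c) n * z ^ n)) sums (z * deriv (deriv F) z)"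
    by (rule sums_mult)
  then have "(\<lambda>n. of_nat (Suc n) * diffs ?c (Suc n) * z ^ Suc n) sums (z * deriv (deriv F) z)"
    by (simp add: diffs_def mult_ac)
  \<comment> \<open>The new term of index 0 vanishes, so this series lines up with that of the first
    derivative.\<close>
  then have "(\<lambda>n. of_nat n * diffs ?c n * z ^ n) sums (z * deriv (deriv F) z)"
    by (subst (asm) sums_Suc_iff) simp
  from sums_add[OF d1[OF z] sums_mult[OF this, of "of_real \<alpha>"]]
  show ?thesis
    by (simp add: euler_op_def diffs_def den_Suc algebra_simps)
qed


subsection \<open>The extremal function\<close>

definition ext_coeff :: "real \<Rightarrow> nat \<Rightarrow> complex" where
  "ext_coeff \<alpha> n = (if n = 0 then 0 else if n = 1 then 1 else of_real (2 / den \<alpha> n))"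

lemma two_div_den_bounds:
  assumes "\<alpha> \<ge> 0" "n \<ge> 2"
  shows "0 < 2 / den \<alpha> n" "2 / den \<alpha> n \<le> 1" "2 / den \<alpha> n \<le> 2 / real n"
  using den_ge[OF assms(1), of n] assms(2) by (auto simp: field_simps)

lemma h_ext_sums:
  assumes "\<alpha> \<ge> 0" "cmod z < 1"
  shows "(\<lambda>n. ext_coeff \<alpha> n * z ^ n) sums h_ext \<alpha> z"
proof -
  have "summable (\<lambda>n. of_real (2 / den \<alpha> (n+2)) * z ^ (n+2))"
  proof (rule summable_comparison_test')
    show "summable (\<lambda>n. cmod z ^ (n+2))"
      using summable_ignore_initial_segment[OF summable_geometric[of "cmod z"], of 2] assms by simp
    fix n :: nat
    have "cmod (of_real (2 / den \<alpha> (n+2)) * z ^ (n+2)) = 2 / den \<alpha> (n+2) * cmod z ^ (n+2)"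
      using two_div_den_bounds(1)[OF assms(1), of "n+2"]
      by (simp add: norm_mult norm_power norm_divide)
    also have "\<dots> \<le> 1 * cmod z ^ (n+2)"
      using two_div_den_bounds(2)[OF assms(1), of "n+2"] by (intro mult_right_mono) auto
    finally show "cmod (of_real (2 / den \<alpha> (n+2)) * z ^ (n+2)) \<le> cmod z ^ (n+2)" by simp
  qed
  then have "(\<lambda>n. ext_coeff \<alpha> (n+2) * z ^ (n+2)) sums (h_ext \<alpha> z - z)"
    by (simp add: h_ext_def ext_coeff_def summable_sums)
  then show ?thesis
    by (subst (asm) sums_iff_shift) (simp add: ext_coeff_def numeral_2_eq_2)
qed

lemma holomorphic_h_ext: "\<alpha> \<ge> 0 \<Longrightarrow> h_ext \<alpha> holomorphic_on ball 0 1"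
  using power_series_holomorphic[of 0 1 "ext_coeff \<alpha>" "h_ext \<alpha>"] h_ext_sums by simp

lemma tcoeff_h_ext: "\<alpha> \<ge> 0 \<Longrightarrow> tcoeff (h_ext \<alpha>) n = ext_coeff \<alpha> n"
  by (rule tcoeff_eqI) (rule h_ext_sums)

text \<open>The coefficients become 1, 2, 2, ..., the expansion of the half-plane map for which the
  bounds of Caratheodory and Harnack are both sharp.\<close>

lemma euler_op_h_ext:
  assumes "\<alpha> \<ge> 0" "cmod z < 1"
  shows "euler_op \<alpha> (h_ext \<alpha>) z = (1 + z) / (1 - z)"
proof -
  have z1: "z \<noteq> 1" using assms by auto
  have "of_real (den \<alpha> (Suc n)) * ext_coeff \<alpha> (Suc n) = (if n = 0 then 1 else 2)" for n
  proof -
    have "den \<alpha> (Suc n) \<noteq> 0" using den_ge[OF assms(1), of "Suc n"] by auto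
    moreover have "den \<alpha> 1 = 1" by (simp add: den_def)
    ultimately show ?thesis by (auto simp: ext_coeff_def)
  qed
  then have eq: "(\<lambda>n. of_real (den \<alpha> (Suc n)) * tcoeff (h_ext \<alpha>) (Suc n) * z ^ n)
      = (\<lambda>n. 2 * z ^ n - (if n = 0 then 1 else 0))"
    using assms by (auto simp: tcoeff_h_ext)
  have "(\<lambda>n. 2 * z ^ n - (if n = 0 then 1 else 0)) sums (2 * (1 / (1 - z)) - 1)"
    by (intro sums_diff sums_mult geometric_sums assms) (use sums_single[of 0 "\<lambda>_. 1::complex"] in simp)
  with euler_op_sums[OF holomorphic_h_ext[OF assms(1)] assms(2), of \<alpha>]
  have "euler_op \<alpha> (h_ext \<alpha>) z = 2 * (1 / (1 - z)) - 1"
    unfolding eq using sums_unique2 by blast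
  then show ?thesis using z1 by (simp add: field_simps)
qed

lemma Re_cayley_pos:
  assumes "cmod z < 1"
  shows "0 < Re ((1 + z) / (1 - z))"
proof -
  have "z \<noteq> 1" using assms by auto
  then have "(Re (1 - z))\<^sup>2 + (Im (1 - z))\<^sup>2 > 0"
    unfolding cmod_power2[symmetric] by simp
  moreover have "(Re z)\<^sup>2 + (Im z)\<^sup>2 < 1"
    using assms by (simp add: abs_square_less_1 flip: cmod_power2)
  ultimately show ?thesis
    by (simp add: Re_divide power2_eq_square algebra_simps)
qed

lemma deriv_h_ext_0: "\<alpha> \<ge> 0 \<Longrightarrow> deriv (h_ext \<alpha>) 0 = 1"
  using euler_op_h_ext[of \<alpha> 0] by (simp add: euler_op_def)

lemma h_ext_0: "h_ext \<alpha> 0 = 0"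
  by (simp add: h_ext_def)

lemma W0H_h_ext:
  assumes "\<alpha> \<ge> 0"
  shows "W0H \<alpha> (h_ext \<alpha>) (\<lambda>_. 0)"
proof -
  have "0 < Re (deriv (h_ext \<alpha>) z + of_real \<alpha> * z * deriv (deriv (h_ext \<alpha>)) z)"
    if "cmod z < 1" for z
    using Re_cayley_pos[OF that] euler_op_h_ext[OF assms that] by (simp add: euler_op_def)
  moreover have "deriv (deriv (\<lambda>_. 0 :: complex)) z = 0" for z :: complex
    by (simp add: deriv_const[abs_def])
  ultimately show ?thesis
    unfolding W0H_def using assms
    by (simp add: holomorphic_h_ext h_ext_0 deriv_h_ext_0)
qed

subsection \<open>Reduction to analytic functions\<close>

definition analytic_W :: "real \<Rightarrow> (complex \<Rightarrow> complex) \<Rightarrow> bool" where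
  "analytic_W \<alpha> F \<longleftrightarrow> F holomorphic_on ball 0 1 \<and> F 0 = 0 \<and> deriv F 0 = 1 \<and>
     (\<forall>z. cmod z < 1 \<longrightarrow> 0 < Re (euler_op \<alpha> F z))"

text \<open>The parameter \<open>u\<close> rotates a chosen radius onto the positive real axis,
  \<open>cnj u\<close> keeps the derivative at 0 equal to 1, and \<open>v\<close> is a free phase
  for the \<open>g\<close> part.\<close>

definition rot_comb :: "(complex \<Rightarrow> complex) \<Rightarrow> (complex \<Rightarrow> complex) \<Rightarrow> complex \<Rightarrow> complex \<Rightarrow> complex \<Rightarrow> complex" where
  "rot_comb h g u v z = cnj u * h (u * z) + v * g (u * z)"

lemma rot_comb_derivs:
  assumes h: "h holomorphic_on ball 0 1" and g: "g holomorphic_on ball 0 1"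
    and u: "cmod u = 1" and z: "cmod z < 1"
  shows "(rot_comb h g u v has_field_derivative deriv h (u * z) + v * u * deriv g (u * z)) (at z)"
    and "deriv (rot_comb h g u v) z = deriv h (u * z) + v * u * deriv g (u * z)"
    and "deriv (deriv (rot_comb h g u v)) z
           = u * deriv (deriv h) (u * z) + v * u\<^sup>2 * deriv (deriv g) (u * z)"
proof -
  have cu: "u * cnj u = 1" using u by (simp flip: complex_norm_square)
  have chain: "((\<lambda>w. f (u * w)) has_field_derivative deriv f (u * w) * u) (at w)"
    if f: "f holomorphic_on ball 0 1" and w: "cmod w < 1" for f w
  proof -
    have "(f has_field_derivative deriv f (u * w)) (at (u * w))"
      using f w u by (intro holomorphic_derivI[of _ "ball 0 1"]) (auto simp: norm_mult)
    then show ?thesis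
      by (rule DERIV_chain2) (auto intro!: derivative_eq_intros)
  qed
  have 1: "(rot_comb h g u v has_field_derivative deriv h (u * w) + v * u * deriv g (u * w)) (at w)"
    if "cmod w < 1" for w
    unfolding rot_comb_def[abs_def]
    using DERIV_add[OF DERIV_cmult[OF chain[OF h that], of "cnj u"] DERIV_cmult[OF chain[OF g that], of v]]
    by (rule DERIV_cong) (simp add: cu mult_ac)
  show "(rot_comb h g u v has_field_derivative deriv h (u * z) + v * u * deriv g (u * z)) (at z)"
    by (rule 1[OF z])
  have 2: "deriv (rot_comb h g u v) w = deriv h (u * w) + v * u * deriv g (u * w)"
    if "cmod w < 1" for w
    using 1[OF that] by (rule DERIV_imp_deriv)
  then show "deriv (rot_comb h g u v) z = deriv h (u * z) + v * u * deriv g (u * z)"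
    using z by blast
  have h': "deriv h holomorphic_on ball 0 1" and g': "deriv g holomorphic_on ball 0 1"
    using h g by (auto intro: holomorphic_deriv)
  have "((\<lambda>w. deriv h (u * w) + v * u * deriv g (u * w)) has_field_derivative
      u * deriv (deriv h) (u * z) + v * u\<^sup>2 * deriv (deriv g) (u * z)) (at z)"
    using DERIV_add[OF chain[OF h' z] DERIV_cmult[OF chain[OF g' z], of "v * u"]]
    by (simp add: power2_eq_square mult_ac)
  then have "(deriv (rot_comb h g u v) has_field_derivative
      u * deriv (deriv h) (u * z) + v * u\<^sup>2 * deriv (deriv g) (u * z)) (at z)"
    by (rule has_field_derivative_transform_within_open[of _ _ _ "ball 0 1"]) (use z 2 in auto)
  then show "deriv (deriv (rot_comb h g u v)) z
           = u * deriv (deriv h) (u * z) + v * u\<^sup>2 * deriv (deriv g) (u * z)"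
    by (rule DERIV_imp_deriv)
qed

text \<open>The unimodular factor \<open>v * u\<close> lowers the real part by at most the modulus
  of the \<open>g\<close> term, which is exactly what the defining inequality of \<open>W0H\<close>
  allows.\<close>

lemma W0H_analytic_W:
  assumes W: "W0H \<alpha> h g" and u: "cmod u = 1" and v: "cmod v = 1"
  shows "analytic_W \<alpha> (rot_comb h g u v)"
proof -
  have h: "h holomorphic_on ball 0 1" and g: "g holomorphic_on ball 0 1"
    using W by (auto simp: W0H_def)
  note d = rot_comb_derivs[OF h g u]
  have "rot_comb h g u v holomorphic_on ball 0 1"
    unfolding holomorphic_on_open[OF open_ball] using d(1) by (metis mem_ball_0)
  moreover have "rot_comb h g u v 0 = 0" "deriv (rot_comb h g u v) 0 = 1"
    using W d(2)[of 0] by (auto simp: W0H_def rot_comb_def)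
  moreover have "0 < Re (euler_op \<alpha> (rot_comb h g u v) z)" if z: "cmod z < 1" for z
  proof -
    have uz: "u * z \<in> ball 0 1" using u z by (simp add: norm_mult)
    let ?G = "euler_op \<alpha> g (u * z)"
    have "euler_op \<alpha> (rot_comb h g u v) z = euler_op \<alpha> h (u * z) + v * u * ?G"
      unfolding euler_op_def d(2,3)[OF z] by (simp add: algebra_simps power2_eq_square)
    moreover have "Re (v * u * ?G) \<ge> - cmod ?G"
      using abs_Re_le_cmod[of "v * u * ?G"] u v by (simp add: norm_mult)
    moreover have "Re (euler_op \<alpha> h (u * z)) > cmod ?G"
      using W uz unfolding W0H_def euler_op_def by blast
    ultimately show ?thesis by simp
  qed
  ultimately show ?thesis by (simp add: analytic_W_def)
qed

section \<open>Harnack's inequality and comparison along a radius\<close>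

text \<open>The Cayley transform \<open>(P - 1) / (P + 1)\<close> maps the disc into itself and
  fixes 0, so the Schwarz lemma applies; squaring and solving for \<open>Re (P z)\<close> gives the
  bound.\<close>

lemma harnack_lower:
  assumes P: "P holomorphic_on ball 0 1" "P 0 = 1"
    and pos: "\<And>z. cmod z < 1 \<Longrightarrow> 0 < Re (P z)" and z: "cmod z < 1"
  shows "(1 - cmod z) / (1 + cmod z) \<le> Re (P z)"
proof -
  define r where "r = cmod z"
  have r: "0 \<le> r" "r < 1" using z by (auto simp: r_def)
  have ne: "P w + 1 \<noteq> 0" if "cmod w < 1" for w
    using pos[OF that] by (auto simp: complex_eq_iff)
  have "cmod ((P z - 1) / (P z + 1)) \<le> cmod z"
  proof (rule Schwarz_Lemma(1)[where f = "\<lambda>z. (P z - 1) / (P z + 1)"])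
    show "(\<lambda>z. (P z - 1) / (P z + 1)) holomorphic_on ball 0 1"
      by (intro holomorphic_intros P) (use ne in auto)
    fix w :: complex assume w: "cmod w < 1"
    have "(cmod (P w - 1))\<^sup>2 < (cmod (P w + 1))\<^sup>2"
      using pos[OF w] unfolding cmod_power2 by (simp add: power2_eq_square algebra_simps)
    then have "cmod (P w - 1) < cmod (P w + 1)" by (rule power2_less_imp_less) simp
    then show "cmod ((P w - 1) / (P w + 1)) < 1"
      using ne[OF w] by (simp add: norm_divide)
  qed (use P z in auto)
  then have "cmod (P z - 1) \<le> r * cmod (P z + 1)"
    using ne[OF z] by (simp add: norm_divide r_def field_simps)
  then have "(cmod (P z - 1))\<^sup>2 \<le> (r * cmod (P z + 1))\<^sup>2"
    by (intro power_mono) auto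
  then have "(Re (P z) - 1)\<^sup>2 + (Im (P z))\<^sup>2 \<le> r\<^sup>2 * ((Re (P z) + 1)\<^sup>2 + (Im (P z))\<^sup>2)"
    by (simp add: power_mult_distrib cmod_power2)
  \<comment> \<open>Since \<open>r\<close> is below 1, the imaginary parts may be dropped from both
    sides.\<close>
  moreover have "r\<^sup>2 * (Im (P z))\<^sup>2 \<le> 1 * (Im (P z))\<^sup>2"
    using r by (intro mult_right_mono) (auto simp: power_le_one)
  ultimately have "(Re (P z) - 1)\<^sup>2 \<le> r\<^sup>2 * (Re (P z) + 1)\<^sup>2"
    by (simp add: algebra_simps)
  then have "\<bar>Re (P z) - 1\<bar> \<le> \<bar>r * (Re (P z) + 1)\<bar>"
    unfolding abs_le_square_iff power_mult_distrib .
  also have "\<dots> = r * (Re (P z) + 1)" using r pos[OF z] by simp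
  finally have "1 - Re (P z) \<le> r * (Re (P z) + 1)" by linarith
  then show ?thesis using r unfolding r_def[symmetric] by (simp add: field_simps)
qed

text \<open>At a negative minimum over \<open>[0,T]\<close> the derivative is nonpositive, which contradicts the differential inequality.\<close>

lemma euler_ode_nonneg:
  fixes \<psi> \<psi>' :: "real \<Rightarrow> real"
  assumes "\<alpha> \<ge> 0" "0 \<le> T" "0 \<le> \<psi> 0"
    and der: "\<And>t. 0 \<le> t \<Longrightarrow> t \<le> T \<Longrightarrow> (\<psi> has_real_derivative \<psi>' t) (at t)"
    and ode: "\<And>t. 0 < t \<Longrightarrow> t \<le> T \<Longrightarrow> 0 \<le> \<psi> t + \<alpha> * t * \<psi>' t"
  shows "0 \<le> \<psi> T"
proof (rule ccontr)
  assume neg: "\<not> 0 \<le> \<psi> T"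
  have "continuous_on {0..T} \<psi>"
    by (rule continuous_at_imp_continuous_on) (use der DERIV_isCont in fastforce)
  then obtain t where t: "0 \<le> t" "t \<le> T" and min: "\<And>s. 0 \<le> s \<Longrightarrow> s \<le> T \<Longrightarrow> \<psi> t \<le> \<psi> s"
    using continuous_attains_inf[of "{0..T}" \<psi>] \<open>0 \<le> T\<close> by auto
  have "\<psi> t < 0" using min[of T] neg \<open>0 \<le> T\<close> by auto
  then have "0 < t" using t \<open>0 \<le> \<psi> 0\<close> by (cases "t = 0") auto
  have "\<psi>' t \<le> 0"
  proof (rule ccontr)
    assume "\<not> \<psi>' t \<le> 0"
    then obtain d where d: "d > 0" "\<And>h. 0 < h \<Longrightarrow> h < d \<Longrightarrow> \<psi> (t - h) < \<psi> t"
      using DERIV_pos_inc_left[OF der[OF t]] by auto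
    obtain k where "0 < k" "k < min d t" using dense[of 0 "min d t"] d \<open>0 < t\<close> by auto
    then show False using d(2)[of k] min[of "t - k"] t by auto
  qed
  then have "\<alpha> * t * \<psi>' t \<le> 0"
    using \<open>\<alpha> \<ge> 0\<close> \<open>0 < t\<close> by (intro mult_nonneg_nonpos) auto
  with ode[OF \<open>0 < t\<close> t(2)] \<open>\<psi> t < 0\<close> show False by linarith
qed

lemma Re_of_real_has_derivative:
  assumes "(G has_field_derivative D) (at (complex_of_real t))"
  shows "((\<lambda>t. Re (G (of_real t))) has_real_derivative Re D) (at t)"
  using bounded_linear.has_vector_derivative[OF bounded_linear_Re has_vector_derivative_real_field[OF assms]]
  by (simp add: has_real_derivative_iff_has_vector_derivative)

lemma Re_of_real_minus_has_derivative:
  assumes "(G has_field_derivative D) (at (- complex_of_real t))"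
  shows "((\<lambda>t. Re (G (- of_real t))) has_real_derivative - Re D) (at t)"
proof -
  have "((\<lambda>z. G (- z)) has_field_derivative D * (-1)) (at (complex_of_real t))"
    by (rule DERIV_chain2[where f = G and g = uminus]) (use assms in \<open>auto intro!: derivative_eq_intros\<close>)
  from Re_of_real_has_derivative[OF this] show ?thesis by simp
qed

lemma holomorphic_derivs:
  assumes "F holomorphic_on ball 0 1" "cmod z < 1"
  shows "(F has_field_derivative deriv F z) (at z)"
    and "(deriv F has_field_derivative deriv (deriv F) z) (at z)"
  using assms by (auto intro!: holomorphic_derivI[of _ "ball 0 1"] holomorphic_deriv)

lemma analytic_W_harnack:
  assumes F: "analytic_W \<alpha> F" and z: "cmod z < 1"
  shows "(1 - cmod z) / (1 + cmod z) \<le> Re (euler_op \<alpha> F z)"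
proof (rule harnack_lower)
  have "F holomorphic_on ball 0 1" using F by (simp add: analytic_W_def)
  then show "euler_op \<alpha> F holomorphic_on ball 0 1"
    unfolding euler_op_def[abs_def] by (intro holomorphic_intros holomorphic_deriv) auto
qed (use F z in \<open>auto simp: analytic_W_def euler_op_def\<close>)

text \<open>The Harnack bound decreases along the radius, so its value \<open>?c\<close> at
  \<open>T\<close> bounds the operator from below on all of \<open>[0,T]\<close>. Comparing with
  this positive constant gives strict positivity.\<close>

lemma analytic_W_Re_deriv_pos:
  assumes "\<alpha> \<ge> 0" and F: "analytic_W \<alpha> F" and T: "0 \<le> T" "T < 1"
  shows "0 < Re (deriv F (of_real T))"
proof -
  have hol: "F holomorphic_on ball 0 1" using F by (simp add: analytic_W_def)
  let ?c = "(1 - T) / (1 + T)"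
  have "0 \<le> Re (deriv F (of_real T)) - ?c"
  proof (rule euler_ode_nonneg[where T = T and \<psi> = "\<lambda>t. Re (deriv F (of_real t)) - ?c"
        and \<psi>' = "\<lambda>t. Re (deriv (deriv F) (of_real t))" and \<alpha> = \<alpha>])
    show "0 \<le> Re (deriv F (of_real 0)) - ?c"
      using F T by (simp add: analytic_W_def)
  next
    fix t :: real
    assume t: "0 \<le> t" "t \<le> T"
    have "((\<lambda>t. Re (deriv F (of_real t))) has_real_derivative Re (deriv (deriv F) (of_real t))) (at t)"
        using t T by (intro Re_of_real_has_derivative holomorphic_derivs(2)[OF hol]) auto
      then show "((\<lambda>t. Re (deriv F (of_real t)) - ?c) has_real_derivative Re (deriv (deriv F) (of_real t))) (at t)"
        using DERIV_diff[OF _ DERIV_const[of ?c "at t"]] by fastforce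
  next
    fix t :: real
    assume t: "0 < t" "t \<le> T"
    have "?c \<le> (1 - t) / (1 + t)" using t T by (simp add: field_simps)
    also have "\<dots> \<le> Re (euler_op \<alpha> F (of_real t))"
      using analytic_W_harnack[OF F, of "of_real t"] t T by simp
    also have "\<dots> = Re (deriv F (of_real t)) + \<alpha> * t * Re (deriv (deriv F) (of_real t))"
      by (simp add: euler_op_def flip: of_real_mult)
    finally show "0 \<le> Re (deriv F (of_real t)) - ?c + \<alpha> * t * Re (deriv (deriv F) (of_real t))"
      by simp
  qed (use assms in auto)
  moreover have "0 < ?c" using T by simp
  ultimately show ?thesis by linarith
qed

text \<open>At \<open>- t\<close> the operator applied to \<open>h_ext\<close> equals the Harnack
  bound \<open>(1 - t) / (1 + t)\<close>. Hence the difference \<psi> of the two derivatives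
  satisfies the hypothesis of \<open>euler_ode_nonneg\<close>, and integrating it compares the
  functions.\<close>

lemma analytic_W_growth:
  assumes "\<alpha> \<ge> 0" and F: "analytic_W \<alpha> F" and T: "0 \<le> T" "T < 1"
  shows "- Re (h_ext \<alpha> (- of_real T)) \<le> Re (F (of_real T))"
proof -
  have hol: "F holomorphic_on ball 0 1" using F by (simp add: analytic_W_def)
  note dF = holomorphic_derivs[OF hol] and dE = holomorphic_derivs[OF holomorphic_h_ext[OF \<open>\<alpha> \<ge> 0\<close>]]
  define \<psi> where "\<psi> = (\<lambda>t. Re (deriv F (of_real t)) - Re (deriv (h_ext \<alpha>) (- of_real t)))"
  define \<psi>' where "\<psi>' = (\<lambda>t. Re (deriv (deriv F) (of_real t)) + Re (deriv (deriv (h_ext \<alpha>)) (- of_real t)))"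
  have \<psi>_nonneg: "0 \<le> \<psi> S" if S: "0 \<le> S" "S \<le> T" for S
  proof (rule euler_ode_nonneg[where \<psi> = \<psi> and T = S and \<psi>' = \<psi>' and \<alpha> = \<alpha>])
    show "0 \<le> \<psi> 0"
      using F \<open>\<alpha> \<ge> 0\<close> by (simp add: \<psi>_def analytic_W_def deriv_h_ext_0)
  next
    fix t :: real
    assume t: "0 \<le> t" "t \<le> S"
    have "((\<lambda>t. Re (deriv F (of_real t)) - Re (deriv (h_ext \<alpha>) (- of_real t))) has_real_derivative
          Re (deriv (deriv F) (of_real t)) - (- Re (deriv (deriv (h_ext \<alpha>)) (- of_real t)))) (at t)"
        using t T S by (intro DERIV_diff Re_of_real_has_derivative Re_of_real_minus_has_derivative dF dE) auto
      then show "(\<psi> has_real_derivative \<psi>' t) (at t)"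
        by (simp add: \<psi>_def \<psi>'_def)
  next
    fix t :: real
    assume t: "0 < t" "t \<le> S"
    have "Re (euler_op \<alpha> (h_ext \<alpha>) (- of_real t)) = Re ((1 - complex_of_real t) / (1 + of_real t))"
      using t S T by (simp add: euler_op_h_ext \<open>\<alpha> \<ge> 0\<close>)
    also have "\<dots> = Re (complex_of_real ((1 - t) / (1 + t)))" by simp
    also have "\<dots> \<le> Re (euler_op \<alpha> F (of_real t))"
      using analytic_W_harnack[OF F, of "of_real t"] t S T unfolding Re_complex_of_real by simp
    finally show "0 \<le> \<psi> t + \<alpha> * t * \<psi>' t"
      by (simp add: \<psi>_def \<psi>'_def euler_op_def algebra_simps flip: of_real_mult)
  qed (use S \<open>\<alpha> \<ge> 0\<close> in auto)
  define q where "q = (\<lambda>t. Re (F (of_real t)) + Re (h_ext \<alpha> (- of_real t)))"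
  have "q 0 \<le> q T"
  proof (rule DERIV_nonneg_imp_nondecreasing[OF T(1)])
    fix t assume t: "0 \<le> t" "t \<le> T"
    have "((\<lambda>t. Re (F (of_real t)) + Re (h_ext \<alpha> (- of_real t))) has_real_derivative
          Re (deriv F (of_real t)) + (- Re (deriv (h_ext \<alpha>) (- of_real t)))) (at t)"
      using t T by (intro DERIV_add Re_of_real_has_derivative Re_of_real_minus_has_derivative dF dE) auto
    then have "(q has_real_derivative \<psi> t) (at t)" by (simp add: q_def \<psi>_def)
    then show "\<exists>y. (q has_real_derivative y) (at t) \<and> 0 \<le> y"
      using \<psi>_nonneg t by blast
  qed
  moreover have "q 0 = 0" using F by (simp add: q_def analytic_W_def h_ext_0)
  ultimately show ?thesis by (simp add: q_def)
qed


subsection \<open>Geometry of the harmonic map\<close>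

text \<open>For \<open>u = sgn z\<close> and \<open>v = u\<close>, the terms \<open>u * g z\<close>
  and \<open>cnj u * cnj (g z)\<close> have equal real parts, so \<open>rot_comb\<close> at
  \<open>cmod z\<close> has the real part of \<open>cnj u\<close> times the harmonic map at
  \<open>z\<close>.\<close>

lemma W0H_growth:
  assumes "\<alpha> \<ge> 0" and W: "W0H \<alpha> h g" and z: "cmod z < 1"
  shows "- Re (h_ext \<alpha> (- of_real (cmod z))) \<le> cmod (h z + cnj (g z))"
proof (cases "z = 0")
  case True
  then show ?thesis by (simp add: h_ext_0)
next
  case False
  define u where "u = sgn z"
  have u: "cmod u = 1" and uz: "u * of_real (cmod z) = z"
    using False by (auto simp: u_def norm_divide sgn_eq)
  have "- Re (h_ext \<alpha> (- of_real (cmod z))) \<le> Re (rot_comb h g u u (of_real (cmod z)))"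
    using z by (intro analytic_W_growth[OF assms(1) W0H_analytic_W[OF W u u]]) auto
  also have "\<dots> = Re (cnj u * (h z + cnj (g z)))"
    by (simp add: rot_comb_def uz algebra_simps)
  also have "\<dots> \<le> cmod (cnj u * (h z + cnj (g z)))" by (rule complex_Re_le_cmod)
  also have "\<dots> = cmod (h z + cnj (g z))" using u by (simp add: norm_mult)
  finally show ?thesis .
qed

text \<open>The phase \<open>v\<close> is chosen so that the \<open>g\<close> part of the derivative
  of \<open>rot_comb\<close> becomes minus its modulus; positivity of the real part is then the
  claim.\<close>

lemma W0H_Re_deriv:
  assumes "\<alpha> \<ge> 0" and W: "W0H \<alpha> h g" and z: "cmod z < 1"
  shows "cmod (deriv g z) < Re (deriv h z)"
proof -
  have "\<exists>u. cmod u = 1 \<and> u * of_real (cmod z) = z"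
  proof (cases "z = 0")
    case True
    then show ?thesis by (intro exI[of _ 1]) auto
  next
    case False
    then show ?thesis by (intro exI[of _ "sgn z"]) (auto simp: norm_divide sgn_eq)
  qed
  then obtain u where u: "cmod u = 1" and uz: "u * of_real (cmod z) = z" by blast
  \<comment> \<open>The value 1 replaces \<open>sgn 0 = 0\<close>, which is not unimodular.\<close>
  define s where "s = (if deriv g z = 0 then 1 else sgn (deriv g z))"
  have s: "cmod s = 1" "deriv g z = s * of_real (cmod (deriv g z))"
    by (auto simp: s_def norm_divide sgn_eq)
  define v where "v = - (cnj s * cnj u)"
  have v: "cmod v = 1" using s u by (simp add: v_def norm_mult)
  have "s * cnj s = 1" "u * cnj u = 1"
    using s u by (simp_all flip: complex_norm_square)
  moreover have "v * u * s = - ((s * cnj s) * (u * cnj u))" by (simp add: v_def mult_ac)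
  ultimately have "v * u * s = -1" by simp
  then have "v * u * deriv g z = - of_real (cmod (deriv g z))"
    by (subst s(2)) (simp flip: mult.assoc)
  moreover have "0 < Re (deriv (rot_comb h g u v) (of_real (cmod z)))"
    using z by (intro analytic_W_Re_deriv_pos[OF assms(1) W0H_analytic_W[OF W u v]]) auto
  ultimately show ?thesis
    using W z rot_comb_derivs(2)[of h g u "of_real (cmod z)" v] u by (simp add: uz W0H_def)
qed

text \<open>A phase \<open>v\<close> makes the two coefficients point in the same direction, so a
  single analytic function carries the sum of their moduli. Coefficient \<open>k\<close> of its
  image under \<open>euler_op\<close> has the factor \<open>den \<alpha> (Suc k)\<close>, and
  Caratheodory bounds it by 2.\<close>

lemma W0H_coeff_bound:
  assumes "\<alpha> \<ge> 0" and W: "W0H \<alpha> h g" and n: "n \<ge> 2"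
  shows "cmod (tcoeff h n) + cmod (tcoeff g n) \<le> 2 / den \<alpha> n"
proof -
  obtain k where k: "n = Suc k" "0 < k" using n by (cases n) auto
  let ?a = "tcoeff h n" and ?b = "tcoeff g n"
  have h: "h holomorphic_on ball 0 1" and g: "g holomorphic_on ball 0 1"
    using W by (auto simp: W0H_def)
  have "\<exists>v. cmod v = 1 \<and> cmod (?a + v * ?b) = cmod ?a + cmod ?b"
  proof (cases "?a = 0 \<or> ?b = 0")
    case True
    then show ?thesis by (intro exI[of _ 1]) auto
  next
    case False
    have "cnj (sgn ?b) * ?b = of_real (cmod ?b)"
      using False complex_norm_square[of ?b] by (simp add: sgn_eq power2_eq_square field_simps)
    then have "?a + sgn ?a * cnj (sgn ?b) * ?b = sgn ?a * of_real (cmod ?a + cmod ?b)"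
      using False by (simp add: mult.assoc) (simp add: sgn_eq ring_distribs)
    then have "cmod (?a + sgn ?a * cnj (sgn ?b) * ?b) = cmod ?a + cmod ?b"
      using False by (simp only: norm_mult norm_of_real) (simp add: norm_sgn)
    then show ?thesis
      using False by (intro exI[of _ "sgn ?a * cnj (sgn ?b)"]) (simp add: norm_mult norm_sgn)
  qed
  then obtain v where v: "cmod v = 1" "cmod (?a + v * ?b) = cmod ?a + cmod ?b" by blast
  define F where "F = rot_comb h g 1 v"
  have F: "analytic_W \<alpha> F" unfolding F_def by (rule W0H_analytic_W[OF W _ v(1)]) simp
  then have hol: "F holomorphic_on ball 0 1" by (simp add: analytic_W_def)
  have tF: "tcoeff F m = tcoeff h m + v * tcoeff g m" for m
  proof (rule tcoeff_eqI)
    fix z :: complex assume z: "cmod z < 1"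
    show "(\<lambda>n. (tcoeff h n + v * tcoeff g n) * z ^ n) sums F z"
      using sums_add[OF tcoeff_sums[OF h z] sums_mult[OF tcoeff_sums[OF g z], of v]]
      by (simp add: F_def rot_comb_def algebra_simps)
  qed
  have "cmod (of_real (den \<alpha> (Suc k)) * tcoeff F (Suc k)) \<le> 2"
  proof (rule positive_real_part_coeff_bound[where P = "euler_op \<alpha> F" and k = k
        and p = "\<lambda>m. of_real (den \<alpha> (Suc m)) * tcoeff F (Suc m)"])
    show "of_real (den \<alpha> (Suc 0)) * tcoeff F (Suc 0) = 1"
      using F by (simp add: analytic_W_def den_def tcoeff_def)
  qed (use F k euler_op_sums[OF hol] in \<open>auto simp: analytic_W_def\<close>)
  then have "den \<alpha> n * (cmod ?a + cmod ?b) \<le> 2"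
    using den_ge[OF assms(1), of n] v(2) by (simp add: norm_mult tF k)
  then show ?thesis using den_ge[OF assms(1), of n] n by (simp add: field_simps)
qed

lemma W0H_continuous:
  assumes "W0H \<alpha> h g"
  shows "continuous_on (ball 0 1) (\<lambda>z. h z + cnj (g z))"
proof -
  have "continuous_on (ball 0 1) h" "continuous_on (ball 0 1) g"
    using assms by (auto simp: W0H_def holomorphic_on_imp_continuous_on)
  then show ?thesis by (intro continuous_intros)
qed

text \<open>The argument of Noshiro and Warschawski: along the segment from \<open>z\<close> to
  \<open>w\<close> with direction \<open>d\<close>, the component of the map along \<open>d\<close>
  is strictly increasing, because its derivative is at least \<open>(cmod d)\<^sup>2\<close> times
  the positive gap between \<open>Re (deriv h y)\<close> and
  \<open>cmod (deriv g y)\<close>.\<close>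

lemma W0H_inj:
  assumes "\<alpha> \<ge> 0" and W: "W0H \<alpha> h g"
  shows "inj_on (\<lambda>z. h z + cnj (g z)) (ball 0 1)"
proof (rule inj_onI, rule ccontr)
  fix z w assume z: "z \<in> ball 0 1" and w: "w \<in> ball 0 1"
    and eq: "h z + cnj (g z) = h w + cnj (g w)" and ne: "z \<noteq> w"
  have h: "h holomorphic_on ball 0 1" and g: "g holomorphic_on ball 0 1"
    using W by (auto simp: W0H_def)
  define d where "d = w - z"
  \<comment> \<open>Conjugating the \<open>g\<close> term leaves the real part unchanged and makes
    the expression analytic in the parameter.\<close>
  define q where "q = (\<lambda>t. Re (cnj d * h (z + of_real t * d) + d * g (z + of_real t * d)))"
  have "q 0 < q 1"
  proof (rule DERIV_pos_imp_increasing[of 0 1 q])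
    fix t :: real assume t: "0 \<le> t" "t \<le> 1"
    define y where "y = z + of_real t * d"
    have "y = (1 - t) *\<^sub>R z + t *\<^sub>R w"
      by (simp add: y_def d_def scaleR_conv_of_real algebra_simps)
    then have y: "y \<in> ball 0 1"
      using convexD[OF convex_ball z w, of "1 - t" t] t by simp
    have chain: "((\<lambda>s. f (z + s * d)) has_field_derivative deriv f y * d) (at (of_real t))"
      if f: "f holomorphic_on ball 0 1" for f
    proof (rule DERIV_chain2[where f = f and g = "\<lambda>s. z + s * d"])
      show "(f has_field_derivative deriv f y) (at (z + of_real t * d))"
        unfolding y_def[symmetric] using f y by (intro holomorphic_derivI) auto
    qed (auto intro!: derivative_eq_intros)
    have "(q has_real_derivative Re (cnj d * (deriv h y * d) + d * (deriv g y * d))) (at t)"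
      unfolding q_def
      by (rule Re_of_real_has_derivative[where G = "\<lambda>s. cnj d * h (z + s * d) + d * g (z + s * d)"])
        (intro DERIV_add DERIV_cmult chain h g)
    moreover have "0 < Re (cnj d * (deriv h y * d) + d * (deriv g y * d))"
    proof -
      have "cnj d * (deriv h y * d) = of_real ((cmod d)\<^sup>2) * deriv h y"
        unfolding complex_norm_square by (simp add: mult_ac)
      then have "Re (cnj d * (deriv h y * d)) = (cmod d)\<^sup>2 * Re (deriv h y)"
        by (simp only: Re_complex_of_real Im_complex_of_real times_complex.sel mult_zero_left diff_zero)
      moreover have "- Re (d * (deriv g y * d)) \<le> (cmod d)\<^sup>2 * cmod (deriv g y)"
        using abs_Re_le_cmod[of "d * (deriv g y * d)"] by (simp add: norm_mult power2_eq_square mult_ac)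
      moreover have "(cmod d)\<^sup>2 * cmod (deriv g y) < (cmod d)\<^sup>2 * Re (deriv h y)"
        using W0H_Re_deriv[OF assms, of y] y ne by (intro mult_strict_left_mono) (auto simp: d_def)
      ultimately show ?thesis by simp
    qed
    ultimately show "\<exists>y. (q has_real_derivative y) (at t) \<and> 0 < y" by blast
  qed simp
  moreover have "q 0 = Re (cnj d * (h z + cnj (g z)))" "q 1 = Re (cnj d * (h w + cnj (g w)))"
    by (auto simp: q_def d_def algebra_simps)
  ultimately show False using eq by simp
qed

lemma W0H_open_image:
  assumes "\<alpha> \<ge> 0" and W: "W0H \<alpha> h g" and S: "open S" "S \<subseteq> ball 0 1"
  shows "open ((\<lambda>z. h z + cnj (g z)) ` S)"
  using S by (intro invariance_of_domain continuous_on_subset[OF W0H_continuous[OF W]]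
      inj_on_subset[OF W0H_inj[OF assms(1) W]]) auto

text \<open>If \<open>w\<close> were the value at \<open>a\<close>, the image of a smaller disc
  around 0 containing \<open>a\<close> would be a neighbourhood of \<open>w\<close>. Injectivity
  would then keep \<open>Z n\<close> inside that disc eventually, against \<open>cmod (Z n)\<close>
  tending to 1.\<close>

lemma W0H_boundary_limit_not_in_image:
  assumes "\<alpha> \<ge> 0" and W: "W0H \<alpha> h g" and Z: "\<And>n. cmod (Z n) < 1" "(\<lambda>n. cmod (Z n)) \<longlonglongrightarrow> 1"
    and lim: "(\<lambda>n. h (Z n) + cnj (g (Z n))) \<longlonglongrightarrow> w"
  shows "w \<notin> (\<lambda>z. h z + cnj (g z)) ` ball 0 1"
proof
  let ?f = "\<lambda>z. h z + cnj (g z)"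
  assume "w \<in> ?f ` ball 0 1"
  then obtain a where a: "cmod a < 1" "w = ?f a" by auto
  obtain \<rho> where \<rho>: "cmod a < \<rho>" "\<rho> < 1" using dense[OF a(1)] by blast
  have "open (?f ` ball 0 \<rho>)" using \<rho> by (intro W0H_open_image[OF assms(1) W]) auto
  moreover have "w \<in> ?f ` ball 0 \<rho>" using a \<rho> by auto
  ultimately have "eventually (\<lambda>n. ?f (Z n) \<in> ?f ` ball 0 \<rho>) sequentially"
    using topological_tendstoD[OF lim] by blast
  moreover have "eventually (\<lambda>n. \<rho> < cmod (Z n)) sequentially"
    using order_tendstoD(1)[OF Z(2) \<rho>(2)] .
  ultimately have "eventually (\<lambda>n. False) sequentially"
  proof eventually_elim
    case (elim n)
    then obtain y where "cmod y < \<rho>" "?f (Z n) = ?f y" by auto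
    then have "Z n = y" using inj_onD[OF W0H_inj[OF assms(1) W], of "Z n" y] Z(1)[of n] \<rho> by auto
    then show ?case using elim \<open>cmod y < \<rho>\<close> by simp
  qed
  then show False by simp
qed

text \<open>Coefficients of order \<open>1 / n\<close> are square summable, so Parseval bounds the
  quadratic means uniformly in \<open>r\<close>, and some sample point lies at or below the
  mean.\<close>

lemma W0H_bounded_on_circles:
  assumes "\<alpha> \<ge> 0" and W: "W0H \<alpha> h g"
  shows "\<exists>C. \<forall>r. 0 \<le> r \<and> r < 1 \<longrightarrow> (\<exists>z. cmod z = r \<and> cmod (h z + cnj (g z)) \<le> C)"
proof -
  have h: "h holomorphic_on ball 0 1" and g: "g holomorphic_on ball 0 1"
    using W by (auto simp: W0H_def)
  \<comment> \<open>Since \<open>inverse 0 = 0\<close>, the bound at index 0 is 0, matching the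
    vanishing constant terms; the factor 2 also covers index 1.\<close>
  define b where "b = (\<lambda>n. (2 * inverse (real n))\<^sup>2)"
  have "summable (\<lambda>n. 4 * inverse ((real n)\<^sup>2))"
    using inverse_power_summable[of 2, where 'a = real] by (intro summable_mult) simp
  then have b: "summable b" by (simp add: b_def power_mult_distrib power_inverse)
  have coeff: "(cmod (tcoeff h n))\<^sup>2 \<le> b n" "(cmod (tcoeff g n))\<^sup>2 \<le> b n" for n
  proof -
    have "cmod (tcoeff h n) + cmod (tcoeff g n) \<le> 2 * inverse (real n)"
    proof -
      consider "n = 0" | "n = 1" | "n \<ge> 2" by linarith
      then show ?thesis
      proof cases
        case 3
        then show ?thesis
          using W0H_coeff_bound[OF assms 3] two_div_den_bounds(3)[OF assms(1) 3]
          by (simp add: divide_inverse)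
      qed (use W in \<open>auto simp: tcoeff_def W0H_def\<close>)
    qed
    then have le: "cmod (tcoeff h n) \<le> 2 * inverse (real n)" "cmod (tcoeff g n) \<le> 2 * inverse (real n)"
      using norm_ge_zero[of "tcoeff h n"] norm_ge_zero[of "tcoeff g n"] by linarith+
    show "(cmod (tcoeff h n))\<^sup>2 \<le> b n"
      unfolding b_def by (rule power_mono[OF le(1) norm_ge_zero])
    show "(cmod (tcoeff g n))\<^sup>2 \<le> b n"
      unfolding b_def by (rule power_mono[OF le(2) norm_ge_zero])
  qed
  define K where "K = sqrt (2 * suminf b)"
  have "\<exists>z. cmod z = r \<and> cmod (h z + cnj (g z)) \<le> 2 * (K + 1)" if r: "0 \<le> r" "r < 1" for r
  proof -
    have "\<exists>M0. \<forall>M\<ge>M0. \<forall>z. cmod z = r \<longrightarrow> cmod (h z - (\<Sum>n<M. tcoeff h n * z ^ n)) \<le> 1"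
      by (rule powser_tail_uniform[OF tcoeff_sums[OF h] r zero_less_one])
    then obtain M1 where M1: "\<forall>M\<ge>M1. \<forall>z. cmod z = r \<longrightarrow>
        cmod (h z - (\<Sum>n<M. tcoeff h n * z ^ n)) \<le> 1" ..
    have "\<exists>M0. \<forall>M\<ge>M0. \<forall>z. cmod z = r \<longrightarrow> cmod (g z - (\<Sum>n<M. tcoeff g n * z ^ n)) \<le> 1"
      by (rule powser_tail_uniform[OF tcoeff_sums[OF g] r zero_less_one])
    then obtain M2 where M2: "\<forall>M\<ge>M2. \<forall>z. cmod z = r \<longrightarrow>
        cmod (g z - (\<Sum>n<M. tcoeff g n * z ^ n)) \<le> 1" ..
    \<comment> \<open>One truncation serves both series, and \<open>Suc\<close> guarantees at least
      one sample point.\<close>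
    define M where "M = Suc (max M1 M2)"
    define x where "x = (\<lambda>j::nat. cis (2 * pi * real j / real M))"
    define S where "S = (\<lambda>f j. \<Sum>n<M. tcoeff f n * (of_real r * x j) ^ n)"
    have mean: "(\<Sum>j<M. (cmod (S f j))\<^sup>2) \<le> real M * suminf b"
      if "\<And>n. (cmod (tcoeff f n))\<^sup>2 \<le> b n" for f
    proof -
      have "(\<Sum>j<M. (cmod (S f j))\<^sup>2) = real M * (\<Sum>n<M. (cmod (tcoeff f n * of_real r ^ n))\<^sup>2)"
        using discrete_parseval[of "\<lambda>n. tcoeff f n * of_real r ^ n" M]
        by (simp add: S_def x_def power_mult_distrib mult.assoc)
      also have "(\<Sum>n<M. (cmod (tcoeff f n * of_real r ^ n))\<^sup>2) \<le> (\<Sum>n<M. b n)"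
      proof (rule sum_mono)
        fix n
        have "(r ^ n)\<^sup>2 \<le> 1" using r by (simp add: power_le_one)
        then have "(cmod (tcoeff f n))\<^sup>2 * (r ^ n)\<^sup>2 \<le> (cmod (tcoeff f n))\<^sup>2 * 1"
          by (intro mult_left_mono) auto
        also have "\<dots> \<le> b n" using that by simp
        finally show "(cmod (tcoeff f n * of_real r ^ n))\<^sup>2 \<le> b n"
          using r by (simp add: norm_mult norm_power power_mult_distrib)
      qed
      also have "(\<Sum>n<M. b n) \<le> suminf b"
        by (rule sum_le_suminf[OF b]) (auto simp: b_def)
      finally show ?thesis by (simp add: mult_left_mono)
    qed
    have "\<exists>j<M. (cmod (S h j))\<^sup>2 + (cmod (S g j))\<^sup>2 \<le> 2 * suminf b"
    proof (rule ccontr)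
      assume "\<not> ?thesis"
      then have "(\<Sum>j<M. 2 * suminf b) < (\<Sum>j<M. (cmod (S h j))\<^sup>2 + (cmod (S g j))\<^sup>2)"
        by (intro sum_strict_mono) (auto simp: M_def not_le)
      then show False using mean[of h, OF coeff(1)] mean[of g, OF coeff(2)]
        by (simp add: sum.distrib)
    qed
    then obtain j where j: "(cmod (S h j))\<^sup>2 + (cmod (S g j))\<^sup>2 \<le> 2 * suminf b" by blast
    have "cmod (S h j) \<le> K" "cmod (S g j) \<le> K"
      unfolding K_def
      using j
      zero_le_power2[of "cmod (S h j)"] zero_le_power2[of "cmod (S g j)"]
      by (intro real_le_rsqrt; linarith)+
    moreover define z where "z = of_real r * x j"
    have z: "cmod z = r" using r by (simp add: z_def x_def norm_mult)
    have "cmod (h z - S h j) \<le> 1" "cmod (g z - S g j) \<le> 1"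
      using M1[rule_format, of M z] M2[rule_format, of M z] z by (auto simp: S_def z_def M_def)
    ultimately have "cmod (h z) \<le> K + 1" "cmod (g z) \<le> K + 1"
      using norm_triangle_ineq2[of "h z" "S h j"] norm_triangle_ineq2[of "g z" "S g j"] by linarith+
    then have "cmod (h z + cnj (g z)) \<le> 2 * (K + 1)"
      using norm_triangle_ineq[of "h z" "cnj (g z)"] by simp
    with z show ?thesis by blast
  qed
  then show ?thesis by blast
qed

text \<open>Only the empty set and the whole plane have empty frontier. Bounded values at points
  approaching the unit circle have a limit point, and this is not a value. Nonemptiness makes the
  infimum in \<open>bdist\<close> meaningful.\<close>

lemma W0H_frontier_nonempty:
  assumes "\<alpha> \<ge> 0" and W: "W0H \<alpha> h g"
  shows "frontier ((\<lambda>z. h z + cnj (g z)) ` ball 0 1) \<noteq> {}"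
proof -
  let ?f = "\<lambda>z. h z + cnj (g z)"
  obtain C where C: "\<And>r. 0 \<le> r \<Longrightarrow> r < 1 \<Longrightarrow> \<exists>z. cmod z = r \<and> cmod (?f z) \<le> C"
    using W0H_bounded_on_circles[OF assms] by blast
  define \<rho> where "\<rho> = (\<lambda>n::nat. 1 - inverse (real (Suc n)))"
  have \<rho>: "0 \<le> \<rho> n" "\<rho> n < 1" for n by (auto simp: \<rho>_def field_simps)
  have \<rho>lim: "\<rho> \<longlonglongrightarrow> 1"
    unfolding \<rho>_def using tendsto_diff[OF tendsto_const LIMSEQ_inverse_real_of_nat] by fastforce
  have "\<forall>n. \<exists>z. cmod z = \<rho> n \<and> cmod (?f z) \<le> C" using C \<rho> by blast
  then have "\<exists>Z. \<forall>n. cmod (Z n) = \<rho> n \<and> cmod (?f (Z n)) \<le> C" by (rule choice)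
  then obtain Z where Z: "\<And>n. cmod (Z n) = \<rho> n" "\<And>n. cmod (?f (Z n)) \<le> C" by blast
  have "\<forall>n. ?f (Z n) \<in> cball 0 C" using Z(2) by simp
  then obtain w s where s: "strict_mono s" "(\<lambda>n. ?f (Z (s n))) \<longlonglongrightarrow> w"
    using seq_compactE[OF compact_imp_seq_compact[OF compact_cball], of "\<lambda>n. ?f (Z n)"]
    unfolding o_def by blast
  have "w \<notin> ?f ` ball 0 1"
  proof (rule W0H_boundary_limit_not_in_image[OF assms, of "Z \<circ> s"])
    show "(\<lambda>n. cmod ((Z \<circ> s) n)) \<longlonglongrightarrow> 1"
      using LIMSEQ_subseq_LIMSEQ[OF \<rho>lim s(1)] by (simp add: Z o_def)
  qed (use \<rho> Z s in \<open>auto simp: o_def\<close>)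
  then have "?f ` ball 0 1 \<noteq> UNIV" by blast
  moreover have "?f ` ball 0 1 \<noteq> {}" by simp
  ultimately show ?thesis unfolding frontier_eq_empty de_Morgan_disj by (intro conjI)
qed


subsection \<open>The radius\<close>

text \<open>The growth bound at radius \<open>r\<close> is
  \<open>r - 2 * alt_sum \<alpha> r\<close>. At \<open>r = 1\<close> and \<alpha> = 0 the series
  converges only conditionally, hence the alternating form suited to Leibniz.\<close>

definition alt_sum :: "real \<Rightarrow> real \<Rightarrow> real" where
  "alt_sum \<alpha> r = (\<Sum>n. (-1) ^ n * (r ^ (n+2) / den \<alpha> (n+2)))"

lemma alt_sum_leibniz:
  assumes "\<alpha> \<ge> 0" "0 \<le> r" "r \<le> 1"
  shows "summable (\<lambda>n. (-1) ^ n * (r ^ (n+2) / den \<alpha> (n+2)))"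
    and "(\<Sum>i<2*n. (-1) ^ i * (r ^ (i+2) / den \<alpha> (i+2))) \<le> alt_sum \<alpha> r"
    and "alt_sum \<alpha> r \<le> (\<Sum>i<2*n+1. (-1) ^ i * (r ^ (i+2) / den \<alpha> (i+2)))"
    and "r ^ (n+2) / den \<alpha> (n+2) \<le> 1 / (real n + 1)"
proof -
  define a where "a = (\<lambda>n. r ^ (n+2) / den \<alpha> (n+2))"
  have den_pos: "den \<alpha> (n+2) > 0" for n using den_ge[OF assms(1), of "n+2"] by simp
  have nonneg: "0 \<le> a n" for n using den_pos[of n] assms by (simp add: a_def)
  have bound: "a n \<le> 1 / (real n + 1)" for n
    unfolding a_def using den_ge[OF assms(1), of "n+2"] assms
    by (intro frac_le) (auto simp: power_le_one simp del: power_Suc)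
  have "a \<longlonglongrightarrow> 0"
  proof (rule tendsto_sandwich[of "\<lambda>_. 0" _ _ "\<lambda>n. 1 / (real n + 1)"])
    show "(\<lambda>n. 1 / (real n + 1)) \<longlonglongrightarrow> 0"
      using LIMSEQ_inverse_real_of_nat by (simp add: divide_inverse add.commute)
  qed (auto simp: nonneg bound)
  moreover have "a (Suc n) \<le> a n" for n
    unfolding a_def
  proof (rule frac_le)
    show "r ^ (Suc n + 2) \<le> r ^ (n + 2)" using assms by (intro power_decreasing) auto
    show "den \<alpha> (n + 2) \<le> den \<alpha> (Suc n + 2)" using assms by (intro den_mono) auto
  qed (use assms den_pos in auto)
  ultimately have L: "summable (\<lambda>n. (-1) ^ n * a n)"
      "(\<Sum>i<2*n. (-1) ^ i * a i) \<le> (\<Sum>i. (-1) ^ i * a i)"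
      "(\<Sum>i. (-1) ^ i * a i) \<le> (\<Sum>i<2*n+1. (-1) ^ i * a i)" for n
    using summable_Leibniz'[of a] nonneg by blast+
  show "summable (\<lambda>n. (-1) ^ n * (r ^ (n+2) / den \<alpha> (n+2)))"
    and "(\<Sum>i<2*n. (-1) ^ i * (r ^ (i+2) / den \<alpha> (i+2))) \<le> alt_sum \<alpha> r"
    and "alt_sum \<alpha> r \<le> (\<Sum>i<2*n+1. (-1) ^ i * (r ^ (i+2) / den \<alpha> (i+2)))"
    and "r ^ (n+2) / den \<alpha> (n+2) \<le> 1 / (real n + 1)"
    using L bound[of n] by (simp_all only: alt_sum_def a_def)
qed

text \<open>An Abel-type limit: an even partial sum misses the limit by at most its next term, which
  is at most \<open>1 / (2 * n + 1)\<close> for all \<open>r\<close> in \<open>[0,1]\<close>.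
  Uniform convergence carries continuity up to the endpoint 1.\<close>

lemma continuous_on_alt_sum:
  assumes "\<alpha> \<ge> 0"
  shows "continuous_on {0..1} (alt_sum \<alpha>)"
proof (rule uniform_limit_theorem)
  let ?P = "\<lambda>n r. \<Sum>i<2*n. (-1) ^ i * (r ^ (i+2) / den \<alpha> (i+2))"
  show "\<forall>\<^sub>F n in sequentially. continuous_on {0..1} (?P n)"
  proof (intro always_eventually allI continuous_intros ballI)
    fix i show "den \<alpha> (i + 2) \<noteq> 0" using den_ge[OF assms, of "i + 2"] by auto
  qed
  show "uniform_limit {0..1} ?P (alt_sum \<alpha>) sequentially"
    unfolding uniform_limit_iff
  proof (intro allI impI)
    fix e :: real assume "e > 0"
    then obtain N where N: "N \<noteq> 0" "inverse (real N) < e"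
      using real_arch_inverse by auto
    have "dist (?P n r) (alt_sum \<alpha> r) < e" if "n \<ge> N" "r \<in> {0..1}" for n r
    proof -
      have r: "0 \<le> r" "r \<le> 1" using that by auto
      have "alt_sum \<alpha> r \<le> ?P n r + r ^ (2*n+2) / den \<alpha> (2*n+2)"
        using alt_sum_leibniz(3)[OF assms r, of n] by simp
      moreover have "r ^ (2*n+2) / den \<alpha> (2*n+2) \<le> 1 / (real (2*n) + 1)"
        using alt_sum_leibniz(4)[OF assms r, of "2*n"] by simp
      moreover have "1 / (real (2*n) + 1) \<le> inverse (real N)"
        using that N by (simp add: field_simps)
      ultimately show ?thesis
        using alt_sum_leibniz(2)[OF assms r, of n] N by (simp add: dist_real_def)
    qed
    then show "\<forall>\<^sub>F n in sequentially. \<forall>r\<in>{0..1}. dist (?P n r) (alt_sum \<alpha> r) < e"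
      unfolding eventually_sequentially by blast
  qed
qed simp

lemma rootRHS_alt_sum:
  assumes "\<alpha> \<ge> 0"
  shows "rootRHS \<alpha> = 1 - 2 * alt_sum \<alpha> 1"
proof -
  have "(\<lambda>n. (-1) ^ (n+1) / den \<alpha> (n+2)) = (\<lambda>n. - ((-1) ^ n * (1 ^ (n+2) / den \<alpha> (n+2))))"
    by simp
  then show ?thesis
    unfolding rootRHS_def alt_sum_def
    using suminf_minus[OF alt_sum_leibniz(1)[OF assms, of 1]] by simp
qed

text \<open>The first term of \<open>alt_sum\<close> alone gives only a nonnegative value when
  \<alpha> = 0; the next two terms supply the strict inequality.\<close>

lemma rootRHS_bounds:
  assumes "\<alpha> \<ge> 0"
  shows "0 < rootRHS \<alpha>" "rootRHS \<alpha> \<le> 1"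
proof -
  have "den \<alpha> 2 = 2 + 2 * \<alpha>" "den \<alpha> 3 = 3 + 6 * \<alpha>" "den \<alpha> 4 = 4 + 12 * \<alpha>"
    by (simp_all add: den_def algebra_simps)
  then have "1 / den \<alpha> 2 \<le> 1 / 2" "1 / den \<alpha> 4 < 1 / den \<alpha> 3"
    using assms by (auto intro!: divide_strict_left_mono simp: field_simps add_pos_nonneg)
  moreover have "alt_sum \<alpha> 1 \<le> 1 / den \<alpha> 2 - 1 / den \<alpha> 3 + 1 / den \<alpha> 4"
    using alt_sum_leibniz(3)[OF assms, of 1 1] by (simp add: eval_nat_numeral lessThan_Suc)
  ultimately show "0 < rootRHS \<alpha>" using rootRHS_alt_sum[OF assms] by linarith
  show "rootRHS \<alpha> \<le> 1"
    using alt_sum_leibniz(2)[OF assms, of 1 0] rootRHS_alt_sum[OF assms] by simp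
qed

lemma summable_majorant_series:
  assumes "\<alpha> \<ge> 0" "\<bar>r\<bar> < 1"
  shows "summable (\<lambda>n. r ^ (n+2) / den \<alpha> (n+2))"
proof (rule summable_comparison_test')
  show "summable (\<lambda>n. \<bar>r\<bar> ^ (n+2))"
    using summable_ignore_initial_segment[OF summable_geometric[of "\<bar>r\<bar>"], of 2] assms by simp
  fix n :: nat
  have "\<bar>r\<bar> ^ (n+2) / den \<alpha> (n+2) \<le> \<bar>r\<bar> ^ (n+2) / 1"
    using den_ge[OF assms(1), of "n+2"] by (intro divide_left_mono) auto
  then show "norm (r ^ (n+2) / den \<alpha> (n+2)) \<le> \<bar>r\<bar> ^ (n+2)"
    using den_ge[OF assms(1), of "n+2"] by (simp add: power_abs abs_mult)
qed

lemma h_ext_of_real: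
  assumes "\<alpha> \<ge> 0" "\<bar>x\<bar> < 1"
  shows "h_ext \<alpha> (of_real x) = of_real (rootLHS \<alpha> x)"
proof -
  have "(\<Sum>n. of_real (2 / den \<alpha> (n+2)) * complex_of_real x ^ (n+2))
      = (\<Sum>n. complex_of_real (2 * (x ^ (n+2) / den \<alpha> (n+2))))"
    by (rule suminf_cong) simp
  also have "\<dots> = of_real (\<Sum>n. 2 * (x ^ (n+2) / den \<alpha> (n+2)))"
    by (rule suminf_of_real[symmetric]) (intro summable_mult summable_majorant_series assms)
  also have "\<dots> = of_real (2 * (\<Sum>n. x ^ (n+2) / den \<alpha> (n+2)))"
    by (subst suminf_mult[OF summable_majorant_series[OF assms]]) (rule refl)
  finally show ?thesis by (simp add: h_ext_def rootLHS_def)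
qed

lemma rootLHS_minus:
  shows "rootLHS \<alpha> (- r) = - (r - 2 * alt_sum \<alpha> r)"
proof -
  have "(- r) ^ (n+2) / den \<alpha> (n+2) = (-1) ^ n * (r ^ (n+2) / den \<alpha> (n+2))" for n
    by (simp add: power_minus[of r] mult_ac)
  then show ?thesis by (simp only: rootLHS_def alt_sum_def)
qed

lemma rootLHS_strict_mono:
  assumes "\<alpha> \<ge> 0" "0 \<le> r" "r < s" "s < 1"
  shows "rootLHS \<alpha> r < rootLHS \<alpha> s"
proof -
  have "(\<Sum>n. r ^ (n+2) / den \<alpha> (n+2)) \<le> (\<Sum>n. s ^ (n+2) / den \<alpha> (n+2))"
  proof (intro suminf_le summable_majorant_series assms)
    fix n show "r ^ (n+2) / den \<alpha> (n+2) \<le> s ^ (n+2) / den \<alpha> (n+2)"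
      using assms den_ge[OF assms(1), of "n+2"]
      by (intro divide_right_mono power_mono) auto
  qed (use assms in auto)
  then show ?thesis using assms by (simp add: rootLHS_def)
qed

lemma root_exists:
  assumes "\<alpha> \<ge> 0"
  shows "\<exists>r. 0 < r \<and> r < 1 \<and> rootLHS \<alpha> r = rootRHS \<alpha>"
proof -
  \<comment> \<open>At \<open>b = 1 - t\<close> the first series term contributes
    \<open>b\<^sup>2 / (1 + \<alpha>)\<close>, at least \<open>t\<close> because \<open>b\<close> is
    at least 3/4; so \<open>rootLHS\<close> is at least 1 there. Stopping at \<open>b\<close> avoids
    the endpoint 1, where the series diverges for \<alpha> = 0.\<close>
  define t where "t = 1 / (4 * (1 + \<alpha>))"
  have t: "0 < t" "t \<le> 1 / 4" "t * (1 + \<alpha>) = 1 / 4"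
    using assms by (auto simp: t_def field_simps)
  define b where "b = 1 - t"
  have b: "0 \<le> b" "3 / 4 \<le> b" "b < 1" using t by (auto simp: b_def)
  have cont: "continuous_on {0..b} (rootLHS \<alpha>)"
  proof -
    have "continuous_on (ball 0 1) (h_ext \<alpha>)"
      by (rule holomorphic_on_imp_continuous_on[OF holomorphic_h_ext[OF assms]])
    then have "continuous_on {0..b} (\<lambda>x. h_ext \<alpha> (of_real x))"
      by (rule continuous_on_compose2[where f = of_real]) (use b in \<open>auto intro!: continuous_intros\<close>)
    then have "continuous_on {0..b} (\<lambda>x. Re (h_ext \<alpha> (of_real x)))"
      by (rule continuous_on_Re)
    then show ?thesis
      by (rule continuous_on_eq) (use b assms in \<open>simp add: h_ext_of_real\<close>)
  qed
  have d: "den \<alpha> 2 = 2 * (1 + \<alpha>)" by (simp add: den_def algebra_simps)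
  have "b\<^sup>2 / den \<alpha> 2 = (\<Sum>n<1. b ^ (n+2) / den \<alpha> (n+2))" by (simp add: numeral_2_eq_2)
  also have "\<dots> \<le> (\<Sum>n. b ^ (n+2) / den \<alpha> (n+2))"
    by (rule sum_le_suminf[OF summable_majorant_series])
      (use b assms order_trans[OF of_nat_0_le_iff den_ge[OF assms]] in \<open>auto intro!: divide_nonneg_nonneg\<close>)
  finally have "b + b\<^sup>2 / (1 + \<alpha>) \<le> rootLHS \<alpha> b"
    using assms by (simp add: rootLHS_def d field_simps)
  moreover have "t \<le> b\<^sup>2 / (1 + \<alpha>)"
  proof -
    have "(3 / 4)\<^sup>2 \<le> b\<^sup>2" using b by (intro power_mono) auto
    then have "t * (1 + \<alpha>) \<le> b\<^sup>2" using t by (simp add: power2_eq_square)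
    then show ?thesis using assms by (simp add: field_simps)
  qed
  ultimately have "rootRHS \<alpha> \<le> rootLHS \<alpha> b"
    using rootRHS_bounds(2)[OF assms] by (simp add: b_def)
  moreover have z: "rootLHS \<alpha> 0 = 0" by (simp add: rootLHS_def)
  ultimately obtain r where "0 \<le> r" "r \<le> b" "rootLHS \<alpha> r = rootRHS \<alpha>"
    using IVT'[OF _ _ b(1) cont] rootRHS_bounds(1)[OF assms] by (metis less_imp_le)
  moreover from this have "r \<noteq> 0" using z rootRHS_bounds(1)[OF assms] by auto
  ultimately show ?thesis using b by (intro exI[of _ r]) auto
qed

lemma growth_tendsto:
  assumes "\<alpha> \<ge> 0" "\<And>n. 0 \<le> \<rho> n" "\<And>n. \<rho> n < 1" "\<rho> \<longlonglongrightarrow> 1"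
  shows "(\<lambda>n. - rootLHS \<alpha> (- \<rho> n)) \<longlonglongrightarrow> rootRHS \<alpha>"
proof -
  have "(\<lambda>n. alt_sum \<alpha> (\<rho> n)) \<longlonglongrightarrow> alt_sum \<alpha> 1"
    by (rule continuous_on_tendsto_compose[OF continuous_on_alt_sum[OF assms(1)] assms(4)])
      (auto intro!: always_eventually less_imp_le assms)
  then have "(\<lambda>n. \<rho> n - 2 * alt_sum \<alpha> (\<rho> n)) \<longlonglongrightarrow> 1 - 2 * alt_sum \<alpha> 1"
    by (intro tendsto_intros assms)
  then show ?thesis
    using assms by (simp add: rootLHS_minus rootRHS_alt_sum)
qed

section \<open>Distance to the boundary and the majorant\<close>

text \<open>The image is open, so a frontier point is a limit of values but not a value. The compact
  image of each smaller closed disc misses it, which pushes the preimages to the unit circle, where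
  the growth bound tends to \<open>rootRHS \<alpha>\<close>.\<close>

lemma W0H_frontier_bound:
  assumes "\<alpha> \<ge> 0" and W: "W0H \<alpha> h g"
    and w: "w \<in> frontier ((\<lambda>z. h z + cnj (g z)) ` ball 0 1)"
  shows "rootRHS \<alpha> \<le> cmod w"
proof -
  let ?f = "\<lambda>z. h z + cnj (g z)"
  have "open (?f ` ball 0 1)" by (intro W0H_open_image[OF assms(1) W]) auto
  then have out: "w \<notin> ?f ` ball 0 1" and "w \<in> closure (?f ` ball 0 1)"
    using w by (auto simp: frontier_def interior_open)
  then obtain y where y: "\<And>n. y n \<in> ?f ` ball 0 1" "y \<longlonglongrightarrow> w"
    unfolding closure_sequential by blast
  have "\<forall>n. \<exists>z. cmod z < 1 \<and> y n = ?f z" using y(1) by (force simp: image_iff)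
  then have "\<exists>Z. \<forall>n. cmod (Z n) < 1 \<and> y n = ?f (Z n)" by (rule choice)
  then obtain Z where Z: "\<And>n. cmod (Z n) < 1" "\<And>n. y n = ?f (Z n)" by blast
  have "(\<lambda>n. cmod (Z n)) \<longlonglongrightarrow> 1"
  proof (rule order_tendstoI)
    fix \<rho> :: real assume "\<rho> < 1"
    have "compact (?f ` cball 0 \<rho>)"
      using \<open>\<rho> < 1\<close> by (intro compact_continuous_image continuous_on_subset[OF W0H_continuous[OF W]]) auto
    then have "open (- (?f ` cball 0 \<rho>))" by (simp add: compact_imp_closed open_Compl)
    moreover have "w \<in> - (?f ` cball 0 \<rho>)" using out \<open>\<rho> < 1\<close> by auto
    ultimately have "\<forall>\<^sub>F n in sequentially. y n \<in> - (?f ` cball 0 \<rho>)"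
      using topological_tendstoD[OF y(2)] by blast
    then show "\<forall>\<^sub>F n in sequentially. \<rho> < cmod (Z n)"
    proof eventually_elim
      case (elim n)
      then have "Z n \<notin> cball 0 \<rho>" unfolding Z(2) by blast
      then show ?case by simp
    qed
  next
    fix \<rho> :: real assume "1 < \<rho>"
    then show "\<forall>\<^sub>F n in sequentially. cmod (Z n) < \<rho>"
      by (intro always_eventually allI) (rule less_trans[OF Z(1)])
  qed
  then have "(\<lambda>n. - rootLHS \<alpha> (- cmod (Z n))) \<longlonglongrightarrow> rootRHS \<alpha>"
    using Z(1) by (intro growth_tendsto assms) auto
  moreover have "(\<lambda>n. cmod (y n)) \<longlonglongrightarrow> cmod w" using y(2) by (rule tendsto_norm)
  moreover have "- rootLHS \<alpha> (- cmod (Z n)) \<le> cmod (y n)" for n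
    using W0H_growth[OF assms(1) W Z(1)[of n]] h_ext_of_real[OF assms(1), of "- cmod (Z n)"] Z(1)[of n]
    by (simp add: Z(2))
  ultimately show ?thesis by (intro LIMSEQ_le[of _ "rootRHS \<alpha>"]) auto
qed

lemma W0H_bdist_ge:
  assumes "\<alpha> \<ge> 0" and W: "W0H \<alpha> h g"
  shows "rootRHS \<alpha> \<le> bdist (\<lambda>z. h z + cnj (g z))"
proof -
  have "h 0 + cnj (g 0) = 0" using W by (simp add: W0H_def)
  then show ?thesis
    unfolding bdist_def
    by (intro cINF_greatest W0H_frontier_nonempty[OF assms])
      (simp add: W0H_frontier_bound[OF assms])
qed

text \<open>Along the negative radius the values tend to \<open>- rootRHS \<alpha>\<close>, a
  frontier point that attains the general lower bound.\<close>

lemma bdist_h_ext: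
  assumes "\<alpha> \<ge> 0"
  shows "bdist (\<lambda>z. h_ext \<alpha> z + cnj 0) = rootRHS \<alpha>"
proof (rule antisym)
  let ?f = "\<lambda>z. h_ext \<alpha> z + cnj 0"
  note W = W0H_h_ext[OF assms]
  show "rootRHS \<alpha> \<le> bdist ?f" using W0H_bdist_ge[OF assms W] .
  define \<rho> where "\<rho> = (\<lambda>n::nat. 1 - inverse (real (Suc n)))"
  have \<rho>: "0 \<le> \<rho> n" "\<rho> n < 1" for n by (auto simp: \<rho>_def field_simps)
  have \<rho>lim: "\<rho> \<longlonglongrightarrow> 1"
    unfolding \<rho>_def using tendsto_diff[OF tendsto_const LIMSEQ_inverse_real_of_nat] by fastforce
  let ?Z = "\<lambda>n. complex_of_real (- \<rho> n)"
  have "(\<lambda>n. rootLHS \<alpha> (- \<rho> n)) \<longlonglongrightarrow> - rootRHS \<alpha>"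
    using tendsto_minus[OF growth_tendsto[OF assms \<rho> \<rho>lim]] by simp
  then have "(\<lambda>n. complex_of_real (rootLHS \<alpha> (- \<rho> n))) \<longlonglongrightarrow> of_real (- rootRHS \<alpha>)"
    by (rule tendsto_of_real)
  then have lim: "(\<lambda>n. ?f (?Z n)) \<longlonglongrightarrow> of_real (- rootRHS \<alpha>)"
    using \<rho> by (subst h_ext_of_real[OF assms]) auto
  have "of_real (- rootRHS \<alpha>) \<notin> ?f ` ball 0 1"
  proof (rule W0H_boundary_limit_not_in_image[OF assms W, of ?Z])
    show "(\<lambda>n. cmod (?Z n)) \<longlonglongrightarrow> 1" using \<rho> \<rho>lim by simp
  qed (use \<rho> lim in auto)
  moreover have "of_real (- rootRHS \<alpha>) \<in> closure (?f ` ball 0 1)"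
    unfolding closure_sequential
    by (rule exI[of _ "\<lambda>n. ?f (?Z n)"]) (use \<rho> lim in \<open>auto intro!: imageI\<close>)
  ultimately have "of_real (- rootRHS \<alpha>) \<in> frontier (?f ` ball 0 1)"
    using interior_subset by (auto simp: frontier_def)
  then have "bdist ?f \<le> cmod (of_real (- rootRHS \<alpha>) - ?f 0)"
    unfolding bdist_def by (intro cINF_lower bdd_belowI2[of _ 0]) auto
  also have "\<dots> = rootRHS \<alpha>" using rootRHS_bounds(1)[OF assms] by (simp add: h_ext_0)
  finally show "bdist ?f \<le> rootRHS \<alpha>" .
qed

lemma majorant_h_ext:
  assumes "\<alpha> \<ge> 0" "0 \<le> r" "r < 1"
  shows "majorant (h_ext \<alpha>) (\<lambda>_. 0) r = rootLHS \<alpha> r"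
proof -
  have "(deriv ^^ n) (\<lambda>_. 0 :: complex) = (\<lambda>_. 0)" for n
    by (induction n) (auto simp: deriv_const[abs_def])
  then have t0: "tcoeff (\<lambda>_. 0) n = 0" for n by (simp add: tcoeff_def)
  have "cmod (tcoeff (h_ext \<alpha>) (n+2)) = 2 / den \<alpha> (n+2)" for n
    using den_ge[OF assms(1), of "n+2"] by (simp add: tcoeff_h_ext[OF assms(1)] ext_coeff_def norm_divide)
  then have "majorant (h_ext \<alpha>) (\<lambda>_. 0) r = r + (\<Sum>n. 2 * (r ^ (n+2) / den \<alpha> (n+2)))"
    unfolding majorant_def t0 by simp
  then show ?thesis
    using assms by (simp only: rootLHS_def suminf_mult[OF summable_majorant_series])
qed

lemma majorant_le_rootLHS:
  assumes "\<alpha> \<ge> 0" and W: "W0H \<alpha> h g" and r: "0 \<le> r" "r < 1"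
  shows "majorant h g r \<le> rootLHS \<alpha> r"
proof -
  let ?c = "\<lambda>n. (cmod (tcoeff h (n+2)) + cmod (tcoeff g (n+2))) * r ^ (n+2)"
  have le: "?c n \<le> 2 * (r ^ (n+2) / den \<alpha> (n+2))" for n
  proof -
    have "?c n \<le> 2 / den \<alpha> (n+2) * r ^ (n+2)"
      using W0H_coeff_bound[OF assms(1) W, of "n+2"] r by (intro mult_right_mono) auto
    then show ?thesis by simp
  qed
  have sm: "summable (\<lambda>n. 2 * (r ^ (n+2) / den \<alpha> (n+2)))"
    using assms by (intro summable_mult summable_majorant_series) auto
  have "suminf ?c \<le> (\<Sum>n. 2 * (r ^ (n+2) / den \<alpha> (n+2)))"
  proof (rule suminf_le[OF le _ sm])
    show "summable ?c"
      by (rule summable_comparison_test'[OF sm, of 0]) (use le r in auto)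
  qed
  then have "suminf ?c \<le> 2 * (\<Sum>n. r ^ (n+2) / den \<alpha> (n+2))"
    using assms by (simp only: suminf_mult[OF summable_majorant_series] abs_of_nonneg)
  then show ?thesis unfolding majorant_def rootLHS_def by linarith
qed

theorem theorem2p4:
  fixes \<alpha> :: real
  assumes "\<alpha> \<ge> 0"
  shows "(\<exists>!r. 0 < r \<and> r < 1 \<and> rootLHS \<alpha> r = rootRHS \<alpha>) \<and>
    (\<forall>r. 0 < r \<and> r < 1 \<and> rootLHS \<alpha> r = rootRHS \<alpha> \<longrightarrow>
      (\<forall>h g. W0H \<alpha> h g \<longrightarrow>
         (\<forall>z. cmod z \<le> r \<longrightarrow> majorant h g (cmod z) \<le> bdist (\<lambda>w. h w + cnj (g w)))) \<and>
      W0H \<alpha> (h_ext \<alpha>) (\<lambda>_. 0) \<and>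
      (\<forall>z. cmod z = r \<longrightarrow>
         majorant (h_ext \<alpha>) (\<lambda>_. 0) (cmod z) = bdist (\<lambda>w. h_ext \<alpha> w + cnj 0)) \<and>
      (\<forall>z. r < cmod z \<and> cmod z < 1 \<longrightarrow>
         majorant (h_ext \<alpha>) (\<lambda>_. 0) (cmod z) > bdist (\<lambda>w. h_ext \<alpha> w + cnj 0)))"
proof (intro conjI allI impI)
  obtain r where r: "0 < r" "r < 1" "rootLHS \<alpha> r = rootRHS \<alpha>"
    using root_exists[OF assms] by blast
  show "\<exists>!r. 0 < r \<and> r < 1 \<and> rootLHS \<alpha> r = rootRHS \<alpha>"
  proof (rule ex1I)
    fix s assume "0 < s \<and> s < 1 \<and> rootLHS \<alpha> s = rootRHS \<alpha>"
    then show "s = r"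
      using r rootLHS_strict_mono[OF assms, of r s] rootLHS_strict_mono[OF assms, of s r]
      by (cases s r rule: linorder_cases) auto
  qed (use r in auto)
next
  fix r h g z
  assume r: "0 < r \<and> r < 1 \<and> rootLHS \<alpha> r = rootRHS \<alpha>" and W: "W0H \<alpha> h g" and z: "cmod z \<le> r"
  have "majorant h g (cmod z) \<le> rootLHS \<alpha> (cmod z)"
    using r z by (intro majorant_le_rootLHS[OF assms W]) auto
  also have "\<dots> \<le> rootLHS \<alpha> r"
    using rootLHS_strict_mono[OF assms, of "cmod z" r] r z by (cases "cmod z = r") auto
  also have "\<dots> \<le> bdist (\<lambda>w. h w + cnj (g w))"
    using W0H_bdist_ge[OF assms W] r by simp
  finally show "majorant h g (cmod z) \<le> bdist (\<lambda>w. h w + cnj (g w))" .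
next
  show "W0H \<alpha> (h_ext \<alpha>) (\<lambda>_. 0)" by (rule W0H_h_ext[OF assms])
next
  fix r z
  assume "0 < r \<and> r < 1 \<and> rootLHS \<alpha> r = rootRHS \<alpha>" "cmod z = r"
  then show "majorant (h_ext \<alpha>) (\<lambda>_. 0) (cmod z) = bdist (\<lambda>w. h_ext \<alpha> w + cnj 0)"
    \<comment> \<open>For \<open>h_ext\<close> the majorant is \<open>rootLHS\<close> and the
      distance is \<open>rootRHS\<close>, so equality is the root equation itself.\<close>
    unfolding bdist_h_ext[OF assms] by (simp add: majorant_h_ext[OF assms])
next
  fix r z
  assume "0 < r \<and> r < 1 \<and> rootLHS \<alpha> r = rootRHS \<alpha>" "r < cmod z \<and> cmod z < 1"
  then show "bdist (\<lambda>w. h_ext \<alpha> w + cnj 0) < majorant (h_ext \<alpha>) (\<lambda>_. 0) (cmod z)"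
    unfolding bdist_h_ext[OF assms]
    using rootLHS_strict_mono[OF assms, of r "cmod z"] by (simp add: majorant_h_ext[OF assms])
qed


end
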